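(* Let $n \ge 2$ be an integer. Let $G$ be either the dicyclic group $$Q_{4n} = \langle x,y \mid x^2 = y^n,\ y^{2n} = 1,\ x^{-1}yx = y^{-1}\rangle \quad(\text{of order } 4n),$$ or the semi-dihedral group $$SD_{8n} = \langle x,y \mid x^2 = y^{4n} = 1,\ x^{-1}yx = y^{2n-1}\rangle \quad(\text{of order } 8n).$$ Then $$D(G) = \left\lceil \frac{|G|+1}{2} \right\rceil.$$
   Context: For a finite group $G$ (written multiplicatively, identity $1$), a sequence over $G$ is a finite sequence of elements of $G$, repetitions allowed. $D(G)$ denotes the least positive integer $k$ such that for every sequence $g_1 g_2 \cdots g_k$ of length $k$ over $G$ there exist indices $1 \le i_1 < i_2 < \cdots < i_m \le k$ with $m \ge 1$ such that $g_{i_1} g_{i_2} \cdots g_{i_m} = 1$, the product being taken in the order of increasing indices (an ordered product-one subsequence). *)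

theory Defs
  imports Complex_Main "HOL-Algebra.Coset"
begin

datatype 'g letter = Gen 'g | GenInv 'g

type_synonym 'g word = "'g letter list"

text \<open>
  A presentation is given by a set of relations \<open>(u, v)\<close>, read \<open>u = v\<close>, between words
  over the letters \<open>a\<close>, \<open>a\<inverse>\<close>, where \<open>a\<close> ranges over the whole type of generators.
  The following is the least congruence on words that contains the relations and makes
  \<open>GenInv a\<close> inverse to \<open>Gen a\<close>.
\<close>

inductive word_eq :: "('g word \<times> 'g word) set \<Rightarrow> 'g word \<Rightarrow> 'g word \<Rightarrow> bool"
  for R where
  refl: "word_eq R u u"
| sym: "word_eq R u v \<Longrightarrow> word_eq R v u"
| trans: "word_eq R u v \<Longrightarrow> word_eq R v w \<Longrightarrow> word_eq R u w"
| cancel: "word_eq R (u @ [Gen a, GenInv a] @ v) (u @ v)"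
| cancel': "word_eq R (u @ [GenInv a, Gen a] @ v) (u @ v)"
| relation: "(r, s) \<in> R \<Longrightarrow> word_eq R (u @ r @ v) (u @ s @ v)"

definition presented_group :: "('g word \<times> 'g word) set \<Rightarrow> 'g word set monoid" where
  "presented_group R =
     \<lparr>carrier = UNIV // {(u, v). word_eq R u v},
      mult = (\<lambda>A B. {w. \<exists>u\<in>A. \<exists>v\<in>B. word_eq R (u @ v) w}),
      one = {w. word_eq R [] w}\<rparr>"

lemma word_eq_context:
  "word_eq R u v \<Longrightarrow> word_eq R (p @ u @ q) (p @ v @ q)"
proof (induction rule: word_eq.induct)
  case (cancel u a v)
  show ?case using word_eq.cancel[of R "p @ u" a "v @ q"] by simp
next
  case (cancel' u a v)
  show ?case using word_eq.cancel'[of R "p @ u" a "v @ q"] by simp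
next
  case (relation r s u v)
  then show ?case using word_eq.relation[of r s R "p @ u" "v @ q"] by simp
qed (blast intro: word_eq.intros)+

lemma word_eq_append:
  assumes "word_eq R u u'" and "word_eq R v v'"
  shows "word_eq R (u @ v) (u' @ v')"
  using word_eq_context[OF assms(1), of "[]" v] word_eq_context[OF assms(2), of u' "[]"]
  by (auto intro: word_eq.trans)

fun letter_inv :: "'g letter \<Rightarrow> 'g letter" where
  "letter_inv (Gen a) = GenInv a"
| "letter_inv (GenInv a) = Gen a"

lemma word_eq_left_inverse: "word_eq R (rev (map letter_inv u) @ u) []"
proof (induction u)
  case (Cons l u)
  have "word_eq R (rev (map letter_inv u) @ [letter_inv l, l] @ u) (rev (map letter_inv u) @ u)"
    by (cases l) (simp_all only: letter_inv.simps word_eq.cancel word_eq.cancel')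
  then show ?case using Cons.IH by (auto intro: word_eq.trans)
qed (simp add: word_eq.refl)

lemma presented_group_carrier_iff:
  "A \<in> carrier (presented_group R) \<longleftrightarrow> (\<exists>u. A = {w. word_eq R u w})"
  by (auto simp: presented_group_def quotient_def)

lemma presented_group_mult:
  "{w. word_eq R u w} \<otimes>\<^bsub>presented_group R\<^esub> {w. word_eq R v w} = {w. word_eq R (u @ v) w}"
  by (auto simp: presented_group_def
      intro: word_eq.refl word_eq.trans[OF word_eq_append])

lemma presented_group_one: "\<one>\<^bsub>presented_group R\<^esub> = {w. word_eq R [] w}"
  by (simp add: presented_group_def)

lemma group_presented_group: "group (presented_group R)"
proof (rule groupI)
  fix A assume "A \<in> carrier (presented_group R)"
  then obtain u where u: "A = {w. word_eq R u w}"
    by (auto simp: presented_group_carrier_iff)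
  have "{w. word_eq R (rev (map letter_inv u) @ u) w} = {w. word_eq R [] w}"
    using word_eq_left_inverse[of R u] by (blast intro: word_eq.trans word_eq.sym)
  then show "\<exists>B\<in>carrier (presented_group R). B \<otimes>\<^bsub>presented_group R\<^esub> A = \<one>\<^bsub>presented_group R\<^esub>"
    by (auto simp: u presented_group_one presented_group_carrier_iff
        intro!: bexI[of _ "{w. word_eq R (rev (map letter_inv u)) w}"] simp: presented_group_mult)
qed (auto simp: presented_group_carrier_iff presented_group_mult presented_group_one)

datatype gen = gen_x | gen_y

definition dicyclic_group :: "nat \<Rightarrow> gen word set monoid" where
  "dicyclic_group n = presented_group
     {(replicate 2 (Gen gen_x), replicate n (Gen gen_y)),
      (replicate (2 * n) (Gen gen_y), []),
      ([GenInv gen_x, Gen gen_y, Gen gen_x], [GenInv gen_y])}"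

definition semidihedral_group :: "nat \<Rightarrow> gen word set monoid" where
  "semidihedral_group n = presented_group
     {(replicate 2 (Gen gen_x), []),
      (replicate (4 * n) (Gen gen_y), []),
      ([GenInv gen_x, Gen gen_y, Gen gen_x], replicate (2 * n - 1) (Gen gen_y))}"

text \<open>
  Sequences are lists; indices start at 0. The list \<open>is\<close> is
  the increasing list of indices \<open>i\<^sub>1 < \<dots> < i\<^sub>m\<close>, with \<open>m \<ge> 1\<close>.
\<close>

definition has_ordered_product_one_subsequence :: "('a, 'b) monoid_scheme \<Rightarrow> 'a list \<Rightarrow> bool" where
  "has_ordered_product_one_subsequence G g \<longleftrightarrow>
     (\<exists>is. is \<noteq> [] \<and> sorted_wrt (<) is \<and> set is \<subseteq> {..<length g} \<and>
           foldr (\<otimes>\<^bsub>G\<^esub>) (map (\<lambda>i. g ! i) is) \<one>\<^bsub>G\<^esub> = \<one>\<^bsub>G\<^esub>)"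

definition ordered_davenport :: "('a, 'b) monoid_scheme \<Rightarrow> nat" where
  "ordered_davenport G =
     (LEAST k. 0 < k \<and>
        (\<forall>g. length g = k \<and> set g \<subseteq> carrier G \<longrightarrow> has_ordered_product_one_subsequence G g))"

end

theory Submission
  imports Defs "HOL-Algebra.Multiplicative_Group"
begin

text \<open>
  Both groups have a cyclic subgroup \<open>C = \<langle>y\<rangle>\<close> of index 2, of order \<open>m\<close>, and \<open>y\<close> repeated
  \<open>m - 1\<close> times followed by \<open>x\<close> has no product-one subsequence. For the upper bound one shows, following
  Olson and White, that a product-one free sequence \<open>S\<close> not contained in a cyclic subgroup has at
  least \<open>2 |S|\<close> distinct ordered subproducts (including the empty one).

  Let \<open>S = f \<cdots> g\<close> be a counterexample of minimal length, with set of subproducts \<open>A\<close>. If deleting \<open>f\<close>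
  or \<open>g\<close> leaves a sequence inside a cyclic subgroup, then \<open>A\<close> contains two disjoint copies of the
  subproducts of that sequence, which is enough. Otherwise either deletion removes exactly one point
  from \<open>A\<close>, so \<open>|A|\<close> is odd, outside \<open>\<langle>g\<rangle>\<close> the set \<open>A\<close> is a union of left cosets of \<open>\<langle>g\<rangle>\<close>, inside \<open>\<langle>g\<rangle>\<close>
  it is an interval \<open>1, g, \<dots>, g\<^sup>T\<close>, and symmetrically for \<open>f\<close>. This forces \<open>f = g\<close>, or else \<open>A\<close>
  is invariant under \<open>f\<close> and \<open>g\<close>, which then have odd order and lie in \<open>C\<close>. In both cases the rotation
  of \<open>S\<close> is again a minimal counterexample. Rotating until the last element \<open>t\<close> is outside \<open>C\<close>, the
  first one must also be \<open>t\<close>; iterating, \<open>S\<close> is constant, a contradiction.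
\<close>

section \<open>Subproducts of sequences\<close>

text \<open>Recursion on the first term replaces index lists, so that induction on the sequence is
  available; \<open>nonempty_products_index\<close> links the two.\<close>

primrec nonempty_products :: "('a, 'b) monoid_scheme \<Rightarrow> 'a list \<Rightarrow> 'a set" where
  "nonempty_products G [] = {}"
| "nonempty_products G (g # s) =
     insert g (nonempty_products G s \<union> (\<lambda>a. g \<otimes>\<^bsub>G\<^esub> a) ` nonempty_products G s)"

text \<open>With the empty product included, adding a term at either end unites the set with one
  translate of itself.\<close>

definition products :: "('a, 'b) monoid_scheme \<Rightarrow> 'a list \<Rightarrow> 'a set" where
  "products G s = insert \<one>\<^bsub>G\<^esub> (nonempty_products G s)"

definition product_one_free :: "('a, 'b) monoid_scheme \<Rightarrow> 'a list \<Rightarrow> bool" where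
  "product_one_free G s \<longleftrightarrow> \<one>\<^bsub>G\<^esub> \<notin> nonempty_products G s"

lemma nonempty_products_index:
  "(\<exists>is. is \<noteq> [] \<and> sorted_wrt (<) is \<and> set is \<subseteq> {..<length g} \<and>
       foldr (\<otimes>\<^bsub>G\<^esub>) (map (\<lambda>i. g ! i) is) \<one>\<^bsub>G\<^esub> = z) \<longleftrightarrow> z \<in> nonempty_products G g"
  if "group G" "set g \<subseteq> carrier G"
proof -
  interpret group G by fact
  let ?P = "\<lambda>g is z. is \<noteq> [] \<and> sorted_wrt (<) is \<and> set is \<subseteq> {..<length g} \<and>
       foldr (\<otimes>\<^bsub>G\<^esub>) (map (\<lambda>i. g ! i) is) \<one>\<^bsub>G\<^esub> = z"
  have fwd: "set g \<subseteq> carrier G \<Longrightarrow> ?P g is z \<Longrightarrow> z \<in> nonempty_products G g" for g "is" z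
  proof (induction g arbitrary: "is" z)
    case Nil
    then show ?case by auto
  next
    case (Cons a g)
    have shift: "foldr (\<otimes>\<^bsub>G\<^esub>) (map (\<lambda>i. (a # g) ! i) js) \<one>\<^bsub>G\<^esub> \<in> nonempty_products G g"
      if js: "js \<noteq> []" "sorted_wrt (<) js" "set js \<subseteq> {..<length (a # g)}" "0 \<notin> set js" for js
    proof -
      \<comment> \<open>An index list avoiding 0 refers only to the tail, so its entries drop by
        one.\<close>
      define ks where "ks = map (\<lambda>i. i - 1) js"
      have eq: "js = map Suc ks"
        unfolding ks_def using js(4) by (simp add: o_def) (induction js; auto)
      have "?P g ks (foldr (\<otimes>\<^bsub>G\<^esub>) (map (\<lambda>i. g ! i) ks) \<one>\<^bsub>G\<^esub>)"
        using js unfolding eq by (auto simp: sorted_wrt_map)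
      then have "foldr (\<otimes>\<^bsub>G\<^esub>) (map (\<lambda>i. g ! i) ks) \<one>\<^bsub>G\<^esub> \<in> nonempty_products G g"
        using Cons.IH Cons.prems by auto
      then show ?thesis unfolding eq by (simp add: o_def)
    qed
    obtain i js where i: "is = i # js" using Cons.prems by (cases "is") auto
    have js0: "0 \<notin> set js" using Cons.prems i by auto
    show ?case
    proof (cases i)
      case 0
      show ?thesis
      proof (cases "js = []")
        case True
        then show ?thesis using Cons.prems i 0 by auto
      next
        case False
        have "z = a \<otimes>\<^bsub>G\<^esub> foldr (\<otimes>\<^bsub>G\<^esub>) (map (\<lambda>i. (a # g) ! i) js) \<one>\<^bsub>G\<^esub>"
          using Cons.prems i 0 by simp
        then show ?thesis using shift[of js] False js0 Cons.prems i by auto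
      qed
    next
      case (Suc k)
      then have "0 \<notin> set is" using i js0 by auto
      then show ?thesis using shift[of "is"] Cons.prems by auto
    qed
  qed
  have bwd: "set g \<subseteq> carrier G \<Longrightarrow> z \<in> nonempty_products G g \<Longrightarrow> \<exists>is. ?P g is z" for g z
  proof (induction g arbitrary: z)
    case Nil
    then show ?case by simp
  next
    case (Cons a g)
    have sh: "?P (a # g) (map Suc js) z" if "?P g js z" for js z
      using that by (auto simp: sorted_wrt_map o_def)
    have sh0: "?P (a # g) (0 # map Suc js) (a \<otimes>\<^bsub>G\<^esub> z)" if "?P g js z" for js z
      using that by (auto simp: sorted_wrt_map o_def)
    have IH: "\<exists>js. ?P g js y" if "y \<in> nonempty_products G g" for y
      using Cons.IH[OF _ that] Cons.prems by simp
    consider "z = a" | "z \<in> nonempty_products G g"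
      | y where "y \<in> nonempty_products G g" "z = a \<otimes>\<^bsub>G\<^esub> y"
      using Cons.prems by auto
    then show ?case
    proof cases
      case 1
      then show ?thesis using Cons.prems by (intro exI[of _ "[0]"]) simp
    next
      case 2
      then show ?thesis using IH sh by blast
    next
      case 3
      then show ?thesis using IH sh0 by blast
    qed
  qed
  show ?thesis using fwd[OF that(2)] bwd[OF that(2)] by blast
qed

lemma has_ordered_product_one_subsequence_iff:
  assumes "group G" "set g \<subseteq> carrier G"
  shows "has_ordered_product_one_subsequence G g \<longleftrightarrow> \<not> product_one_free G g"
  using nonempty_products_index[OF assms] 
  unfolding has_ordered_product_one_subsequence_def product_one_free_def by simp

lemma products_Nil [simp]: "products G [] = {\<one>\<^bsub>G\<^esub>}"
  by (simp add: products_def)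

lemma finite_products [simp]: "finite (products G s)"
  by (induction s) (auto simp: products_def)

lemma one_in_products [simp]: "\<one>\<^bsub>G\<^esub> \<in> products G s"
  by (simp add: products_def)

section \<open>Growth of the set of subproducts\<close>

context group
begin

lemma nonempty_products_closed: "set s \<subseteq> carrier G \<Longrightarrow> nonempty_products G s \<subseteq> carrier G"
  by (induction s) auto

lemma products_closed: "set s \<subseteq> carrier G \<Longrightarrow> products G s \<subseteq> carrier G"
  using nonempty_products_closed by (auto simp: products_def)

lemma products_Cons:
  "g \<in> carrier G \<Longrightarrow> products G (g # s) = products G s \<union> (\<lambda>a. g \<otimes> a) ` products G s"
  by (auto simp: products_def)

lemma nonempty_products_append:
  assumes "set s \<subseteq> carrier G" "set u \<subseteq> carrier G"
  shows "nonempty_products G (s @ u) = nonempty_products G s \<union> nonempty_products G u \<union>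
     (\<Union>a\<in>nonempty_products G s. (\<lambda>b. a \<otimes> b) ` nonempty_products G u)"
  using assms(1)
proof (induction s)
  case (Cons g s)
  let ?S = "nonempty_products G s" and ?U = "nonempty_products G u"
  have c: "?S \<subseteq> carrier G" "?U \<subseteq> carrier G" "g \<in> carrier G"
    using nonempty_products_closed Cons.prems assms by auto
  have "(\<lambda>b. g \<otimes> (a \<otimes> b)) ` ?U = (\<lambda>b. g \<otimes> a \<otimes> b) ` ?U" if "a \<in> ?S" for a
    using c that by (intro image_cong[OF HOL.refl]) (simp add: m_assoc subset_iff)
  then have "(\<lambda>a. g \<otimes> a) ` (\<Union>a\<in>?S. (\<lambda>b. a \<otimes> b) ` ?U) =
      (\<Union>a\<in>(\<lambda>a. g \<otimes> a) ` ?S. (\<lambda>b. a \<otimes> b) ` ?U)"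
    by (simp add: image_UN image_image)
  moreover have "nonempty_products G (s @ u) = ?S \<union> ?U \<union> (\<Union>a\<in>?S. (\<lambda>b. a \<otimes> b) ` ?U)"
    using Cons by simp
  ultimately show ?case
    by (simp only: append_Cons nonempty_products.simps image_Un UN_insert UN_Un Un_insert_left) auto
qed simp

lemma products_snoc:
  assumes "set s \<subseteq> carrier G" "g \<in> carrier G"
  shows "products G (s @ [g]) = products G s \<union> (\<lambda>a. a \<otimes> g) ` products G s"
  using assms by (auto simp: products_def nonempty_products_append)

text \<open>A trivial product using both parts has the form \<open>a \<otimes> b = \<one>\<close>,
  and then \<open>b \<otimes> a = \<one>\<close> too.\<close>

lemma product_one_free_rotate:
  assumes "set s \<subseteq> carrier G" "set u \<subseteq> carrier G" "product_one_free G (s @ u)"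
  shows "product_one_free G (u @ s)"
proof -
  have "a \<otimes> b = \<one> \<Longrightarrow> b \<otimes> a = \<one>" if "a \<in> nonempty_products G u" "b \<in> nonempty_products G s" for a b
    using that assms nonempty_products_closed by (meson inv_comm subsetD)
  then show ?thesis
    using assms(3) unfolding product_one_free_def nonempty_products_append[OF assms(1,2)]
      nonempty_products_append[OF assms(2,1)] by (simp add: image_iff) metis
qed

lemma product_one_free_Cons:
  assumes "set s \<subseteq> carrier G" "g \<in> carrier G"
  shows "product_one_free G (g # s) \<longleftrightarrow> product_one_free G s \<and> inv g \<notin> products G s"
proof -
  have "g \<otimes> a = \<one> \<longleftrightarrow> a = inv g" if "a \<in> nonempty_products G s" for a
    using that assms nonempty_products_closed[OF assms(1)]
    by (metis inv_equality inv_inv r_inv subsetD)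
  moreover have "g = \<one> \<longleftrightarrow> inv g = \<one>" using assms(2) by (simp add: inv_eq_1_iff)
  ultimately show ?thesis
    unfolding product_one_free_def products_def by (auto simp: image_iff; metis)
qed

lemma product_one_free_snoc:
  assumes "set s \<subseteq> carrier G" "g \<in> carrier G"
  shows "product_one_free G (s @ [g]) \<longleftrightarrow> product_one_free G s \<and> inv g \<notin> products G s"
proof -
  have "set [g] \<subseteq> carrier G" using assms by simp
  then have "product_one_free G (s @ [g]) \<longleftrightarrow> product_one_free G ([g] @ s)"
    using assms(1) product_one_free_rotate by blast
  then show ?thesis using product_one_free_Cons[OF assms] by simp
qed

text \<open>Were nothing gained, left multiplication by \<open>g\<close> would permute the finite
  set \<open>products G s\<close>; the preimage of \<open>\<one>\<close> would be
  \<open>inv g\<close>, against product-one freeness.\<close>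

lemma products_Cons_strict:
  assumes "set s \<subseteq> carrier G" "g \<in> carrier G" "product_one_free G (g # s)"
  shows "card (products G s) < card (products G (g # s))"
proof -
  have "products G s \<noteq> products G (g # s)"
  proof
    assume "products G s = products G (g # s)"
    then have sub: "(\<lambda>a. g \<otimes> a) ` products G s \<subseteq> products G s"
      using products_Cons[OF assms(2)] by blast
    have "inj_on (\<lambda>a. g \<otimes> a) (products G s)"
      using assms products_closed by (meson inj_on_cmult inj_on_subset)
    then have "(\<lambda>a. g \<otimes> a) ` products G s = products G s"
      using sub by (intro card_subset_eq) (auto simp: card_image)
    then obtain a where "a \<in> products G s" "g \<otimes> a = \<one>"
      by (metis imageE one_in_products)
    then have "inv g \<in> products G s"
      using assms products_closed by (metis inv_comm inv_equality subsetD)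
    then show False using assms by (simp add: product_one_free_Cons)
  qed
  then show ?thesis using products_Cons[OF assms(2)] by (intro psubset_card_mono) auto
qed

lemma products_snoc_strict:
  assumes "set s \<subseteq> carrier G" "g \<in> carrier G" "product_one_free G (s @ [g])"
  shows "card (products G s) < card (products G (s @ [g]))"
proof -
  have "products G s \<noteq> products G (s @ [g])"
  proof
    assume "products G s = products G (s @ [g])"
    then have sub: "(\<lambda>a. a \<otimes> g) ` products G s \<subseteq> products G s"
      using products_snoc[OF assms(1,2)] by blast
    have "inj_on (\<lambda>a. a \<otimes> g) (products G s)"
      using products_closed[OF assms(1)] assms(2) by (intro inj_onI) (meson right_cancel subsetD)
    then have "(\<lambda>a. a \<otimes> g) ` products G s = products G s"
      using sub by (intro card_subset_eq) (auto simp: card_image)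
    then obtain a where "a \<in> products G s" "a \<otimes> g = \<one>"
      by (metis imageE one_in_products)
    then have "inv g \<in> products G s"
      using assms products_closed by (metis inv_equality subsetD)
    then show False using assms by (simp add: product_one_free_snoc)
  qed
  then show ?thesis using products_snoc[OF assms(1,2)] by (intro psubset_card_mono) auto
qed

lemma card_products_ge:
  assumes "set s \<subseteq> carrier G" "product_one_free G s"
  shows "length s < card (products G s)"
  using assms
proof (induction s)
  case (Cons g s)
  then have "length s < card (products G s)" by (simp add: product_one_free_Cons)
  then show ?case using products_Cons_strict[of s g] Cons.prems by simp
qed simp

end

section \<open>Sequences with few subproducts\<close>

text \<open>Meant for translation by a group element, with \<open>e\<close> the identity and
  \<open>h\<close> the order. As \<open>A\<close> exceeds \<open>B\<close> by at most one point, the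
  first orbit point \<open>p\<close> outside \<open>B\<close> is the only new one. So every other
  point of \<open>A\<close> is in \<open>B\<close> and has its image in \<open>A\<close>.\<close>

lemma orbit_initial_run:
  fixes \<sigma> :: "'a \<Rightarrow> 'a"
  assumes fin: "finite B" and A: "A = B \<union> \<sigma> ` B" and cA: "card A \<le> Suc (card B)"
    and e: "e \<in> B" and h: "0 < h" and inj: "inj_on (\<lambda>i. (\<sigma> ^^ i) e) {..<h}"
    and last: "(\<sigma> ^^ (h - 1)) e \<notin> B"
  obtains T where "0 < T" "T < h" "\<And>i. i < h \<Longrightarrow> (\<sigma> ^^ i) e \<in> A \<longleftrightarrow> i \<le> T"
    "\<And>x. x \<in> A \<Longrightarrow> (\<And>i. x \<noteq> (\<sigma> ^^ i) e) \<Longrightarrow> \<sigma> x \<in> A"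
proof -
  define T where "T = (LEAST i. (\<sigma> ^^ i) e \<notin> B)"
  define p where "p = (\<sigma> ^^ T) e"
  have pB: "p \<notin> B" unfolding p_def T_def using last by (rule LeastI)
  have below: "(\<sigma> ^^ i) e \<in> B" if "i < T" for i
    using not_less_Least[of i "\<lambda>i. (\<sigma> ^^ i) e \<notin> B"] that by (auto simp: T_def)
  have "T \<le> h - 1" unfolding T_def using last by (rule Least_le)
  then have Th: "T < h" using h by simp
  have T0: "0 < T" using e pB by (cases T) (auto simp: p_def)
  then have "p = \<sigma> ((\<sigma> ^^ (T - 1)) e)" by (cases T) (auto simp: p_def)
  then have pA: "p \<in> A" using below[of "T - 1"] T0 A by auto
  have "insert p B = A"
    using pA A fin cA pB by (intro card_seteq) auto
  then have Ap: "A = insert p B" by simp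
  \<comment> \<open>A return to \<open>B\<close> would last up to index \<open>h - 1\<close>,
    contradicting \<open>last\<close>: each image is in \<open>A = insert p B\<close> and, the orbit
    points being distinct, is not \<open>p\<close>.\<close>
  have above: "(\<sigma> ^^ i) e \<notin> B" if "T < i" "i < h" for i
  proof
    assume "(\<sigma> ^^ i) e \<in> B"
    have "(\<sigma> ^^ (i + j)) e \<in> B" if "i + j < h" for j
      using that
    proof (induction j)
      case (Suc j)
      then have "(\<sigma> ^^ (i + Suc j)) e \<in> A" using A by simp
      moreover have "(\<sigma> ^^ (i + Suc j)) e \<noteq> p"
        using inj_onD[OF inj, of "i + Suc j" T] Suc.prems \<open>T < i\<close> Th unfolding p_def by auto
      ultimately show ?case using Ap by simp
    qed (use \<open>(\<sigma> ^^ i) e \<in> B\<close> in simp)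
    from this[of "h - 1 - i"] last \<open>i < h\<close> show False by simp
  qed
  show thesis
  proof
    show "0 < T" "T < h" by fact+
    show "(\<sigma> ^^ i) e \<in> A \<longleftrightarrow> i \<le> T" if "i < h" for i
    proof (cases i T rule: linorder_cases)
      case less
      then show ?thesis using below Ap by simp
    next
      case equal
      then show ?thesis using pA by (simp add: p_def)
    next
      case greater
      moreover have "(\<sigma> ^^ i) e \<noteq> p"
        using inj_onD[OF inj, of i T] greater that Th unfolding p_def by auto
      ultimately show ?thesis using above[OF greater that] Ap by simp
    qed
    show "\<sigma> x \<in> A" if "x \<in> A" "\<And>i. x \<noteq> (\<sigma> ^^ i) e" for x
      using that Ap A p_def by auto
  qed
qed

section \<open>Parity from maps without fixed points\<close>

lemma even_card_involution:
  assumes "finite A" "\<And>x. x \<in> A \<Longrightarrow> \<sigma> x \<in> A" "\<And>x. x \<in> A \<Longrightarrow> \<sigma> (\<sigma> x) = x"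
    "\<And>x. x \<in> A \<Longrightarrow> \<sigma> x \<noteq> x"
  shows "even (card A)"
  using assms
proof (induction A rule: finite_psubset_induct)
  case (psubset A)
  show ?case
  proof (cases "A = {}")
    case False
    then obtain a where a: "a \<in> A" by blast
    let ?B = "A - {a, \<sigma> a}"
    have sa: "\<sigma> a \<in> A" "\<sigma> a \<noteq> a" using psubset.prems a by auto
    have "even (card ?B)"
    proof (rule psubset.IH)
      show "?B \<subset> A" using a by blast
      show "\<sigma> x \<in> ?B" if "x \<in> ?B" for x
        using that psubset.prems(1,2) a by (metis DiffD1 DiffD2 DiffI insert_iff singletonD)
    qed (use psubset.prems in auto)
    moreover have "card A = card ?B + 2"
      using a sa psubset.hyps card_Diff_subset[of "{a, \<sigma> a}" A] card_mono[of A "{a, \<sigma> a}"] by auto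
    ultimately show ?thesis by simp
  qed simp
qed

text \<open>Either \<open>\<sigma>\<close> is itself an involution without fixed points, or its
  square is one.\<close>

lemma even_card_torsion_four:
  fixes \<sigma> :: "'a \<Rightarrow> 'a"
  assumes "finite A" "\<And>x. x \<in> A \<Longrightarrow> \<sigma> x \<in> A" "\<And>x. x \<in> A \<Longrightarrow> \<sigma> (\<sigma> (\<sigma> (\<sigma> x))) = x"
    and "\<And>x. x \<in> A \<Longrightarrow> \<sigma> x \<noteq> x"
    and "(\<forall>x\<in>A. \<sigma> (\<sigma> x) = x) \<or> (\<forall>x\<in>A. \<sigma> (\<sigma> x) \<noteq> x)"
  shows "even (card A)"
  using assms(5)
proof
  assume "\<forall>x\<in>A. \<sigma> (\<sigma> x) = x"
  then show ?thesis using even_card_involution[of A \<sigma>] assms by blast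
next
  assume "\<forall>x\<in>A. \<sigma> (\<sigma> x) \<noteq> x"
  then show ?thesis using even_card_involution[of A "\<lambda>x. \<sigma> (\<sigma> x)"] assms by simp
qed

context group
begin

abbreviation powers :: "'a \<Rightarrow> 'a set" where
  "powers g \<equiv> range (\<lambda>i::nat. g [^] i)"

text \<open>The extreme case \<open>T = ord g - 1\<close>, equivalent to
  \<open>inv g \<in> A\<close>, is allowed: then \<open>A\<close> contains all of
  \<open>powers g\<close>. The bounds on \<open>T\<close> also force \<open>g \<in> A\<close> and
  \<open>g \<noteq> \<one>\<close>.\<close>

definition initial_run :: "'a set \<Rightarrow> 'a \<Rightarrow> nat \<Rightarrow> bool" where
  "initial_run A g T \<longleftrightarrow> 0 < T \<and> T < ord g \<and> (\<forall>i<ord g. g [^] i \<in> A \<longleftrightarrow> i \<le> T)"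

definition in_cyclic_subgroup :: "'a set \<Rightarrow> bool" where
  "in_cyclic_subgroup S \<longleftrightarrow> (\<exists>z\<in>carrier G. S \<subseteq> powers z)"

text \<open>A counterexample to the bound of \<open>card_products_noncyclic\<close>.\<close>

definition small_products :: "'a list \<Rightarrow> bool" where
  "small_products s \<longleftrightarrow> set s \<subseteq> carrier G \<and> product_one_free G s \<and>
     \<not> in_cyclic_subgroup (set s) \<and> card (products G s) < 2 * length s"

lemma pow_four: "f \<in> carrier G \<Longrightarrow> f [^] (4::nat) = f \<otimes> (f \<otimes> (f \<otimes> f))"
  by (simp add: numeral_eq_Suc m_assoc)

lemma pow_mult_twist:
  assumes "x \<in> carrier G" "y \<in> carrier G" "y \<otimes> x = x \<otimes> y [^] (r::nat)"
  shows "y [^] i \<otimes> x = x \<otimes> y [^] (r * i)"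
proof (induction i)
  case (Suc i)
  have "y [^] Suc i \<otimes> x = y [^] i \<otimes> (x \<otimes> y [^] r)" using assms by (simp add: m_assoc)
  also have "\<dots> = x \<otimes> (y [^] (r * i) \<otimes> y [^] r)" using Suc assms by (simp add: m_assoc[symmetric])
  finally show ?case using assms by (simp add: nat_pow_mult algebra_simps)
qed (use assms in simp)

context
  assumes finite_carrier: "finite (carrier G)"
begin

lemma powers_eq_generate: "g \<in> carrier G \<Longrightarrow> powers g = generate G {g}"
  using generate_pow_nat[of g] ord_ge_1[OF finite_carrier] by (fastforce simp: image_def)

lemma subgroup_powers: "g \<in> carrier G \<Longrightarrow> subgroup (powers g) G"
  using powers_eq_generate generate_is_subgroup[of "{g}"] by simp

lemma self_in_powers: "g \<in> carrier G \<Longrightarrow> g \<in> powers g"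
  using nat_pow_eone by (intro range_eqI[of _ _ 1]) simp

lemma powers_lessE:
  assumes "g \<in> carrier G" "x \<in> powers g"
  obtains i where "i < ord g" "x = g [^] i"
proof -
  have "x \<in> {g [^] x |x::nat. x \<in> {0..ord g - 1}}"
    using assms ord_elems[OF finite_carrier assms(1)] by auto
  then obtain i where "x = g [^] i" "i \<in> {0..ord g - 1}" by blast
  then show thesis using that[of i] ord_ge_1[OF finite_carrier assms(1)] by simp
qed

lemma inv_eq_pow: "g \<in> carrier G \<Longrightarrow> inv g = g [^] (ord g - 1)"
  using ord_ge_1[OF finite_carrier, of g] pow_ord_eq_1[of g]
  by (intro inv_equality) (simp_all flip: nat_pow_Suc)

lemma pow_inj: "g \<in> carrier G \<Longrightarrow> i < ord g \<Longrightarrow> j < ord g \<Longrightarrow> g [^] i = g [^] j \<Longrightarrow> i = j" for i j :: nat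
  using inj_onD[OF ord_inj, of g i j] by force

lemma initial_run_full:
  assumes "g \<in> carrier G" "initial_run A g T" "inv g \<in> A"
  shows "powers g \<subseteq> A"
proof
  fix x assume "x \<in> powers g"
  then obtain i where "i < ord g" "x = g [^] i" using assms(1) powers_lessE by metis
  moreover have "ord g - 1 \<le> T"
    using assms unfolding initial_run_def inv_eq_pow[OF assms(1)] by simp
  ultimately show "x \<in> A" using assms(2) unfolding initial_run_def by auto
qed

text \<open>This is \<open>orbit_initial_run\<close> for right multiplication by \<open>g\<close>,
  started at \<open>\<one>\<close>. The last orbit point is \<open>inv g\<close>, which product-one
  freeness keeps out of \<open>products G s\<close>.\<close>

lemma products_snoc_run:
  assumes s: "set s \<subseteq> carrier G" "g \<in> carrier G" "product_one_free G (s @ [g])"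
    and c: "card (products G (s @ [g])) \<le> Suc (card (products G s))"
  obtains T where "initial_run (products G (s @ [g])) g T"
    "\<And>x. x \<in> products G (s @ [g]) \<Longrightarrow> x \<notin> powers g \<Longrightarrow> x \<otimes> g \<in> products G (s @ [g])"
proof -
  have it: "((\<lambda>a. a \<otimes> g) ^^ i) \<one> = g [^] i" for i
    by (induction i) (use s in auto)
  show thesis
  proof (rule orbit_initial_run[OF finite_products products_snoc[OF s(1,2)] c one_in_products])
    show "0 < ord g" using ord_ge_1[OF finite_carrier s(2)] by simp
    show "inj_on (\<lambda>i. ((\<lambda>a. a \<otimes> g) ^^ i) \<one>) {..<ord g}"
      unfolding it using pow_inj s(2) by (auto intro: inj_onI)
    show "((\<lambda>a. a \<otimes> g) ^^ (ord g - 1)) \<one> \<notin> products G s"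
      unfolding it using s inv_eq_pow[OF s(2)] by (simp add: product_one_free_snoc)
  qed (auto simp: it initial_run_def intro!: that)
qed

lemma products_Cons_run:
  assumes s: "set s \<subseteq> carrier G" "g \<in> carrier G" "product_one_free G (g # s)"
    and c: "card (products G (g # s)) \<le> Suc (card (products G s))"
  obtains T where "initial_run (products G (g # s)) g T"
    "\<And>x. x \<in> products G (g # s) \<Longrightarrow> x \<notin> powers g \<Longrightarrow> g \<otimes> x \<in> products G (g # s)"
proof -
  have it: "((\<lambda>a. g \<otimes> a) ^^ i) \<one> = g [^] i" for i
  proof (induction i)
    case (Suc i)
    then show ?case using nat_pow_Suc2[OF s(2), of i] by simp
  qed simp
  show thesis
  proof (rule orbit_initial_run[OF finite_products products_Cons[OF s(2)] c one_in_products])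
    show "0 < ord g" using ord_ge_1[OF finite_carrier s(2)] by simp
    show "inj_on (\<lambda>i. ((\<lambda>a. g \<otimes> a) ^^ i) \<one>) {..<ord g}"
      unfolding it using pow_inj s(2) by (auto intro: inj_onI)
    show "((\<lambda>a. g \<otimes> a) ^^ (ord g - 1)) \<one> \<notin> products G s"
      unfolding it using s inv_eq_pow[OF s(2)] by (simp add: product_one_free_Cons)
  qed (auto simp: it initial_run_def intro!: that)
qed


text \<open>The left coset of \<open>powers g\<close> through \<open>x\<close> misses
  \<open>powers g\<close>, so the one-step hypothesis can be iterated along it.\<close>

lemma right_closed_powers:
  assumes "A \<subseteq> carrier G" "g \<in> carrier G" "\<And>x. x \<in> A \<Longrightarrow> x \<notin> powers g \<Longrightarrow> x \<otimes> g \<in> A"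
    and "x \<in> A" "x \<notin> powers g" "p \<in> powers g"
  shows "x \<otimes> p \<in> A"
proof -
  interpret P: subgroup "powers g" G using subgroup_powers assms(2) .
  have x: "x \<in> carrier G" using assms by blast
  have "x \<otimes> g [^] i \<in> A \<and> x \<otimes> g [^] i \<notin> powers g" for i :: nat
  proof (induction i)
    case 0
    then show ?case using x assms by simp
  next
    case (Suc i)
    have eq: "x \<otimes> g [^] Suc i = (x \<otimes> g [^] i) \<otimes> g" using x assms(2) by (simp add: m_assoc)
    have "x \<in> powers g" if "x \<otimes> g [^] Suc i \<in> powers g"
    proof -
      have "x = (x \<otimes> g [^] Suc i) \<otimes> inv (g [^] Suc i)"
        using x assms(2) by (simp add: m_assoc del: nat_pow_Suc)
      then show ?thesis using that by (metis P.m_closed P.m_inv_closed rangeI)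
    qed
    then show ?case using assms(3,5) Suc.IH unfolding eq by blast
  qed
  then show ?thesis using assms(6) by blast
qed

lemma left_closed_powers:
  assumes "A \<subseteq> carrier G" "g \<in> carrier G" "\<And>x. x \<in> A \<Longrightarrow> x \<notin> powers g \<Longrightarrow> g \<otimes> x \<in> A"
    and "x \<in> A" "x \<notin> powers g" "p \<in> powers g"
  shows "p \<otimes> x \<in> A"
proof -
  interpret P: subgroup "powers g" G using subgroup_powers assms(2) .
  have x: "x \<in> carrier G" using assms by blast
  have "g [^] i \<otimes> x \<in> A \<and> g [^] i \<otimes> x \<notin> powers g" for i :: nat
  proof (induction i)
    case 0
    then show ?case using x assms by simp
  next
    case (Suc i)
    have eq: "g [^] Suc i \<otimes> x = g \<otimes> (g [^] i \<otimes> x)"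
      using x assms(2) nat_pow_Suc2[of g i] by (simp add: m_assoc del: nat_pow_Suc)
    have "x \<in> powers g" if "g [^] Suc i \<otimes> x \<in> powers g"
    proof -
      have "x = inv (g [^] Suc i) \<otimes> (g [^] Suc i \<otimes> x)"
        using x assms(2) by (metis inv_closed l_inv l_one m_assoc nat_pow_closed)
      then show ?thesis using that by (metis P.m_closed P.m_inv_closed rangeI)
    qed
    then show ?case using assms(3,5) Suc.IH unfolding eq by blast
  qed
  then show ?thesis using assms(6) by blast
qed

section \<open>Comparing the runs at the two ends\<close>

lemma powers_subset: "f \<in> carrier G \<Longrightarrow> g \<in> powers f \<Longrightarrow> powers g \<subseteq> powers f"
  by (auto simp: nat_pow_pow)

lemma inv_in_powers: "g \<in> carrier G \<Longrightarrow> inv g \<in> powers g"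
  using inv_eq_pow by simp

text \<open>Here \<open>powers g\<close> is a proper subgroup of \<open>powers f\<close>. With
  \<open>g = f [^] d\<close>, closure takes \<open>f\<close> to \<open>f [^] Suc d\<close>, so the
  run also contains \<open>f [^] (d - 1)\<close>; this lies outside \<open>powers g\<close>, and
  multiplying it by \<open>inv g\<close> gives \<open>inv f\<close>.\<close>

lemma inv_in_proper_run:
  assumes f: "f \<in> carrier G" and g: "g \<in> powers f" "g \<noteq> \<one>" "f \<notin> powers g"
    and run: "initial_run A f S"
    and closed: "\<And>x p. x \<in> A \<Longrightarrow> x \<in> powers f \<Longrightarrow> x \<notin> powers g \<Longrightarrow> p \<in> powers g \<Longrightarrow> x \<otimes> p \<in> A"
  shows "inv f \<in> A"
proof -
  obtain d where d: "d < ord f" "g = f [^] d" using f g powers_lessE by metis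
  have gc: "g \<in> carrier G" using d f by simp
  interpret P: subgroup "powers g" G using subgroup_powers gc .
  have S: "0 < S" "S < ord f" "\<And>i. i < ord f \<Longrightarrow> f [^] i \<in> A \<longleftrightarrow> i \<le> S"
    using run by (auto simp: initial_run_def)
  have "d \<noteq> 0" using d g by auto
  \<comment> \<open>Equality would mean \<open>g = inv f\<close> and put \<open>f\<close> into
    \<open>powers g\<close>. Excluding it lets the run be tested at \<open>Suc d\<close>.\<close>
  have "d \<noteq> ord f - 1"
    using g(3) inv_in_powers[OF gc] d(2) inv_eq_pow[OF f] inv_inv[OF f] by metis
  then have d1: "Suc d < ord f" using d(1) by simp
  have "f \<in> A" using S(3)[of 1] S(1,2) f by simp
  then have "f \<otimes> g \<in> A" using closed[of f g] g f gc self_in_powers by blast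
  moreover have "f \<otimes> g = f [^] Suc d" using d f nat_pow_Suc2 by metis
  ultimately have "Suc d \<le> S" using S(3)[OF d1] by simp
  then have "f [^] (d - 1) \<in> A" using S(3)[of "d - 1"] d(1) by simp
  moreover have fd: "f [^] (d - 1) \<otimes> f = g"
    using \<open>d \<noteq> 0\<close> d(2) by (cases d) auto
  moreover have "f [^] (d - 1) \<notin> powers g"
  proof
    assume "f [^] (d - 1) \<in> powers g"
    then have "inv (f [^] (d - 1)) \<otimes> g \<in> powers g"
      using P.m_closed P.m_inv_closed self_in_powers[OF gc] by blast
    moreover have "inv (f [^] (d - 1)) \<otimes> g = f"
      using fd f gc by (metis inv_solve_left nat_pow_closed)
    ultimately show False using g(3) by simp
  qed
  ultimately have "f [^] (d - 1) \<otimes> inv g \<in> A"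
    using closed[of "f [^] (d - 1)" "inv g"] P.m_inv_closed[OF self_in_powers[OF gc]] by blast
  moreover have "f [^] (d - 1) \<otimes> inv g = inv f"
  proof -
    have "inv g = inv f \<otimes> inv (f [^] (d - 1))" using fd f by (metis inv_mult_group nat_pow_closed)
    also have "\<dots> = inv (f [^] (d - 1)) \<otimes> inv f"
      using f by (metis inv_mult_group nat_pow_closed nat_pow_Suc nat_pow_Suc2)
    finally show ?thesis using f by (simp add: m_assoc[symmetric])
  qed
  ultimately show ?thesis by simp
qed

text \<open>Both elements generate the same cyclic group, and \<open>A\<close> cuts a proper
  interval out of it in either ordering. Multiplication by \<open>g\<close> leaves that interval
  only from \<open>g [^] T\<close>; in exponents of \<open>f\<close> it is a shift by
  \<open>d \<ge> 2\<close>, which tends to leave from several places.\<close>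

lemma initial_run_generator_unique:
  assumes f: "f \<in> carrier G" and g: "g \<in> powers f" "g \<noteq> \<one>" "f \<in> powers g"
    and run: "initial_run A f S" "initial_run A g T" and nA: "inv f \<notin> A"
  shows "f = g"
proof (rule ccontr)
  assume ne: "f \<noteq> g"
  obtain d where d: "d < ord f" "g = f [^] d" using f g powers_lessE by metis
  have gc: "g \<in> carrier G" using d f by simp
  have S: "0 < S" "S < ord f" "\<And>i. i < ord f \<Longrightarrow> f [^] i \<in> A \<longleftrightarrow> i \<le> S"
    using run by (auto simp: initial_run_def)
  have T: "0 < T" "T < ord g" "\<And>i. i < ord g \<Longrightarrow> g [^] i \<in> A \<longleftrightarrow> i \<le> T"
    using run by (auto simp: initial_run_def)
  have "g \<in> A" using T(3)[of 1] T(1,2) gc by simp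
  then have dS: "d \<le> S" using S(3) d by simp
  have d2: "2 \<le> d" using d(2) g(2) ne f by (cases d; cases "d - 1") auto
  have Sh: "S + 1 < ord f"
    using nA S(3)[of "ord f - 1"] S(2) inv_eq_pow[OF f] by auto
  have last: "x = g [^] T" if "x \<in> A" "x \<in> powers f" "x \<otimes> g \<notin> A" for x
  proof -
    have "x \<in> powers g" using that(2) powers_subset[OF gc g(3)] by blast
    then obtain j where j: "j < ord g" "x = g [^] j" using gc powers_lessE by metis
    then have "j \<le> T" using T(3) that(1) by simp
    moreover have "\<not> j < T" using T(3)[of "Suc j"] T(2) that(3) j by auto
    ultimately show ?thesis using j by simp
  qed
  have *: "f [^] (i - d) = g [^] T" if "S < i" "i < ord f" "i - d \<le> S" "d \<le> i" for i
  proof (rule last)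
    show "f [^] (i - d) \<in> A" using S(3) that by simp
    have "f [^] (i - d) \<otimes> g = f [^] i" using that d(2) f by (simp add: nat_pow_mult)
    then show "f [^] (i - d) \<otimes> g \<notin> A" using S(3) that by simp
  qed simp
  have e1: "f [^] (S + 1 - d) = g [^] T" using *[of "S + 1"] d2 dS Sh by simp
  show False
  \<comment> \<open>If two powers of \<open>f\<close> are missing from \<open>A\<close>, the steps
    to exponents \<open>S + 1\<close> and \<open>S + 2\<close> leave \<open>A\<close> from different
    points, yet both start at \<open>g [^] T\<close>. Otherwise only \<open>inv f\<close> is
    missing, and since \<open>inv g\<close> is missing as well the two agree.\<close>
  proof (cases "S + 2 < ord f")
    case True
    then have "f [^] (S + 2 - d) = g [^] T" using *[of "S + 2"] d2 dS by simp
    then have "S + 2 - d = S + 1 - d" using e1 True d2 by (intro pow_inj[OF f]) auto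
    then show False using dS by linarith
  next
    case False
    have "inv g \<notin> A"
    proof
      assume "inv g \<in> A"
      then have "powers g \<subseteq> A" using initial_run_full gc run(2) by blast
      moreover have "inv f \<in> powers g" using inv_in_powers[OF f] powers_subset[OF gc g(3)] by blast
      ultimately show False using nA by blast
    qed
    moreover have "inv g \<in> powers f" using inv_in_powers[OF gc] powers_subset[OF f g(1)] by blast
    then obtain i where i: "i < ord f" "inv g = f [^] i" using f powers_lessE by metis
    ultimately have "S < i" using S(3) by (metis not_le)
    then have "i = ord f - 1" using i False by linarith
    then have "inv g = inv f" using i inv_eq_pow[OF f] by simp
    then show False using ne f gc by (metis inv_inv)
  qed
qed

text \<open>The cases are the inclusions between \<open>powers f\<close> and
  \<open>powers g\<close>. For incomparable groups, right invariance gives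
  \<open>f \<otimes> inv g \<in> A\<close>; this is outside \<open>powers f\<close>, so left
  invariance strips \<open>f\<close> and leaves \<open>inv g\<close>. The other cases use the two
  preceding lemmas.\<close>

lemma ends_of_runs:
  assumes A: "A \<subseteq> carrier G" and f: "f \<in> carrier G" "f \<noteq> \<one>" and g: "g \<in> carrier G" "g \<noteq> \<one>"
    and run: "initial_run A f S" "initial_run A g T"
    and left: "\<And>x. x \<in> A \<Longrightarrow> x \<notin> powers f \<Longrightarrow> f \<otimes> x \<in> A"
    and right: "\<And>x. x \<in> A \<Longrightarrow> x \<notin> powers g \<Longrightarrow> x \<otimes> g \<in> A"
  shows "f = g \<or> inv f \<in> A \<and> inv g \<in> A"
proof -
  have fA: "f \<in> A" and gA: "g \<in> A"
    using run f g nat_pow_eone unfolding initial_run_def by (metis One_nat_def Suc_leI le_less_trans)+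
  have lp: "p \<otimes> x \<in> A" if "x \<in> A" "x \<notin> powers f" "p \<in> powers f" for x p
    using left_closed_powers[OF A f(1) left] that by blast
  have rp: "x \<otimes> p \<in> A" if "x \<in> A" "x \<notin> powers g" "p \<in> powers g" for x p
    using right_closed_powers[OF A g(1) right] that by blast
  have fullf: "inv g \<in> A" if "inv f \<in> A" "g \<in> powers f"
    using initial_run_full[OF f(1) run(1) that(1)] powers_subset[OF f(1) that(2)] inv_in_powers[OF g(1)] by blast
  have fullg: "inv f \<in> A" if "inv g \<in> A" "f \<in> powers g"
    using initial_run_full[OF g(1) run(2) that(1)] powers_subset[OF g(1) that(2)] inv_in_powers[OF f(1)] by blast
  consider "g \<notin> powers f" "f \<notin> powers g" | "g \<in> powers f" "f \<notin> powers g"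
    | "g \<notin> powers f" "f \<in> powers g" | "g \<in> powers f" "f \<in> powers g" by blast
  then show ?thesis
  proof cases
    case 1
    interpret F: subgroup "powers f" G using subgroup_powers f(1) .
    interpret P: subgroup "powers g" G using subgroup_powers g(1) .
    have ff: "f \<in> powers f" "g \<in> powers g" using self_in_powers f g by auto
    have "f \<otimes> inv g \<in> A" using rp[OF fA 1(2)] inv_in_powers g by blast
    moreover have "f \<otimes> inv g \<notin> powers f"
    proof
      assume "f \<otimes> inv g \<in> powers f"
      then have "inv (f \<otimes> inv g) \<otimes> f \<in> powers f" using F.m_closed F.m_inv_closed ff(1) by blast
      then show False using 1(1) f g by (simp add: inv_mult_group m_assoc)
    qed
    ultimately have "inv f \<otimes> (f \<otimes> inv g) \<in> A" using lp inv_in_powers f by blast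
    then have "inv g \<in> A" using f g by (simp add: m_assoc[symmetric])
    have "inv f \<otimes> g \<in> A" using lp[OF gA 1(1)] inv_in_powers f by blast
    moreover have "inv f \<otimes> g \<notin> powers g"
    proof
      assume "inv f \<otimes> g \<in> powers g"
      then have "g \<otimes> inv (inv f \<otimes> g) \<in> powers g" using P.m_closed P.m_inv_closed ff(2) by blast
      then show False using 1(2) f g by (simp add: inv_mult_group m_assoc[symmetric])
    qed
    ultimately have "inv f \<otimes> g \<otimes> inv g \<in> A" using rp inv_in_powers g by blast
    then have "inv f \<in> A" using f g by (simp add: m_assoc)
    then show ?thesis using \<open>inv g \<in> A\<close> by blast
  next
    case 2
    then have "inv f \<in> A" using inv_in_proper_run[OF f(1) 2(1) g(2) 2(2) run(1)] rp by blast
    then show ?thesis using fullf 2 by blast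
  next
    case 3
    \<comment> \<open>Inside the abelian group \<open>powers g\<close>, left invariance under
      \<open>powers f\<close> becomes the right invariance that \<open>inv_in_proper_run\<close>
      needs.\<close>
    have "x \<otimes> p \<in> A" if "x \<in> A" "x \<in> powers g" "x \<notin> powers f" "p \<in> powers f" for x p
    proof -
      have "p \<in> powers g" using that(4) powers_subset[OF g(1) 3(2)] by (rule rev_subsetD)
      then obtain j :: nat where j: "p = g [^] j" by (rule rangeE)
      from that(2) obtain i :: nat where "x = g [^] i" by (rule rangeE)
      with j have "x \<otimes> p = p \<otimes> x" using g by (simp add: nat_pow_mult add.commute)
      then show ?thesis using lp that by simp
    qed
    then have "inv g \<in> A" using inv_in_proper_run[OF g(1) 3(2) f(2) 3(1) run(2)] by blast
    then show ?thesis using fullg 3 by blast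
  next
    case 4
    then show ?thesis
      using initial_run_generator_unique[OF f(1) 4(1) g(2) 4(2) run] fullf by blast
  qed
qed

text \<open>Whether the square of a translation fixes a point depends on \<open>f\<close> alone,
  which gives the dichotomy of \<open>even_card_torsion_four\<close>.\<close>

lemma even_card_left_mult:
  assumes A: "A \<subseteq> carrier G" and f: "f \<in> carrier G" "f \<noteq> \<one>" "f [^] (4::nat) = \<one>"
    and closed: "\<And>x. x \<in> A \<Longrightarrow> f \<otimes> x \<in> A"
  shows "even (card A)"
proof (rule even_card_torsion_four[where \<sigma> = "\<lambda>x. f \<otimes> x"])
  show "finite A" using A finite_carrier finite_subset by blast
  have car: "x \<in> carrier G" if "x \<in> A" for x using that A by blast
  show "f \<otimes> (f \<otimes> (f \<otimes> (f \<otimes> x))) = x" if "x \<in> A" for x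
    using f car[OF that] unfolding pow_four[OF f(1)] by (simp add: m_assoc[symmetric])
  show "f \<otimes> x \<noteq> x" if "x \<in> A" for x using f car[OF that] by (metis l_one right_cancel one_closed)
  have "f \<otimes> (f \<otimes> x) = x \<longleftrightarrow> f \<otimes> f = \<one>" if "x \<in> A" for x
    using f car[OF that] by (metis l_one right_cancel one_closed m_assoc m_closed)
  then show "(\<forall>x\<in>A. f \<otimes> (f \<otimes> x) = x) \<or> (\<forall>x\<in>A. f \<otimes> (f \<otimes> x) \<noteq> x)" by blast
qed (fact closed)

lemma even_card_right_mult:
  assumes A: "A \<subseteq> carrier G" and f: "f \<in> carrier G" "f \<noteq> \<one>" "f [^] (4::nat) = \<one>"
    and closed: "\<And>x. x \<in> A \<Longrightarrow> x \<otimes> f \<in> A"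
  shows "even (card A)"
proof (rule even_card_torsion_four[where \<sigma> = "\<lambda>x. x \<otimes> f"])
  show "finite A" using A finite_carrier finite_subset by blast
  have car: "x \<in> carrier G" if "x \<in> A" for x using that A by blast
  show "x \<otimes> f \<otimes> f \<otimes> f \<otimes> f = x" if "x \<in> A" for x
    using f car[OF that] unfolding pow_four[OF f(1)] by (simp add: m_assoc)
  show "x \<otimes> f \<noteq> x" if "x \<in> A" for x using f car[OF that] by (metis r_one Units_eq Units_l_cancel one_closed)
  have "x \<otimes> f \<otimes> f = x \<longleftrightarrow> f \<otimes> f = \<one>" if "x \<in> A" for x
    using f car[OF that] by (metis r_one Units_eq Units_l_cancel one_closed m_assoc m_closed)
  then show "(\<forall>x\<in>A. x \<otimes> f \<otimes> f = x) \<or> (\<forall>x\<in>A. x \<otimes> f \<otimes> f \<noteq> x)" by blast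
qed (fact closed)

section \<open>Minimal counterexamples\<close>

lemma products_in_powers:
  assumes "z \<in> carrier G" "set s \<subseteq> powers z"
  shows "products G s \<subseteq> powers z"
proof -
  interpret P: subgroup "powers z" G using subgroup_powers[OF assms(1)] .
  have "nonempty_products G s \<subseteq> powers z" using assms(2)
    by (induction s) auto
  then show ?thesis by (simp add: products_def)
qed

text \<open>The subproducts of \<open>s\<close> lie in a cyclic group without \<open>f\<close>, so
  they are disjoint from their translate by \<open>f\<close>; either set has more than
  \<open>length s\<close> elements.\<close>

lemma card_products_cyclic_snoc:
  assumes s: "set s \<subseteq> carrier G" "f \<in> carrier G" "product_one_free G s"
    and cyc: "in_cyclic_subgroup (set s)" "\<not> in_cyclic_subgroup (set (s @ [f]))"
  shows "2 * length (s @ [f]) \<le> card (products G (s @ [f]))"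
proof -
  obtain z where z: "z \<in> carrier G" "set s \<subseteq> powers z"
    using cyc(1) by (auto simp: in_cyclic_subgroup_def)
  interpret P: subgroup "powers z" G using subgroup_powers[OF z(1)] .
  have fz: "f \<notin> powers z" using cyc(2) z by (auto simp: in_cyclic_subgroup_def)
  let ?B = "products G s"
  have B: "?B \<subseteq> powers z" using products_in_powers z by blast
  have "f \<in> powers z" if "b \<in> powers z" "b \<otimes> f \<in> powers z" for b
  proof -
    have "f = inv b \<otimes> (b \<otimes> f)" using that(1) s(2) P.subset by (simp add: m_assoc[symmetric] subset_iff)
    then show ?thesis using that by (metis P.m_closed P.m_inv_closed)
  qed
  then have "?B \<inter> (\<lambda>a. a \<otimes> f) ` ?B = {}" using B fz by blast
  moreover have "inj_on (\<lambda>a. a \<otimes> f) ?B"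
    using inj_on_subset[OF inj_on_multc[OF s(2)] products_closed[OF s(1)]] .
  ultimately have "card (products G (s @ [f])) = 2 * card ?B"
    unfolding products_snoc[OF s(1,2)] by (simp add: card_Un_disjoint card_image)
  then show ?thesis using card_products_ge[OF s(1,3)] by simp
qed

lemma card_products_cyclic_Cons:
  assumes s: "set s \<subseteq> carrier G" "f \<in> carrier G" "product_one_free G s"
    and cyc: "in_cyclic_subgroup (set s)" "\<not> in_cyclic_subgroup (set (f # s))"
  shows "2 * length (f # s) \<le> card (products G (f # s))"
proof -
  obtain z where z: "z \<in> carrier G" "set s \<subseteq> powers z"
    using cyc(1) by (auto simp: in_cyclic_subgroup_def)
  interpret P: subgroup "powers z" G using subgroup_powers[OF z(1)] .
  have fz: "f \<notin> powers z" using cyc(2) z by (auto simp: in_cyclic_subgroup_def)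
  let ?B = "products G s"
  have B: "?B \<subseteq> powers z" using products_in_powers z by blast
  have "f \<in> powers z" if "b \<in> powers z" "f \<otimes> b \<in> powers z" for b
  proof -
    have "f = (f \<otimes> b) \<otimes> inv b" using that(1) s(2) P.subset by (simp add: m_assoc subset_iff)
    then show ?thesis using that by (metis P.m_closed P.m_inv_closed)
  qed
  then have "?B \<inter> (\<lambda>a. f \<otimes> a) ` ?B = {}" using B fz by blast
  moreover have "inj_on (\<lambda>a. f \<otimes> a) ?B"
    using inj_on_subset[OF inj_on_cmult[OF s(2)] products_closed[OF s(1)]] .
  ultimately have "card (products G (f # s)) = 2 * card ?B"
    unfolding products_Cons[OF s(2)] by (simp add: card_Un_disjoint card_image)
  then show ?thesis using card_products_ge[OF s(1,3)] by simp
qed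

text \<open>The hypothesis \<open>torsion\<close> makes every set invariant under translation by an
  element outside \<open>powers y\<close> even; \<open>conj\<close> moves a right factor from
  \<open>powers y\<close> to the left as a power of itself.\<close>

lemma minimal_small_products_rotate:
  assumes y: "y \<in> carrier G"
    and conj: "\<And>c x. c \<in> powers y \<Longrightarrow> x \<in> carrier G \<Longrightarrow> \<exists>j::nat. x \<otimes> c = c [^] j \<otimes> x"
    and torsion: "\<And>x. x \<in> carrier G \<Longrightarrow> x \<notin> powers y \<Longrightarrow> x [^] (4::nat) = \<one>"
    and small: "small_products s"
    and minimal: "\<And>u. length u < length s \<Longrightarrow> \<not> small_products u"
  shows "small_products (rotate1 s) \<and> (last s \<notin> powers y \<longrightarrow> hd s = last s)"
proof -
  note s = small[unfolded small_products_def]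
  have "s \<noteq> []"
    using s one_closed by (auto simp: in_cyclic_subgroup_def)
  then obtain f s' where s': "s = f # s'" by (cases s) auto
  have "s' \<noteq> []"
    using s s' self_in_powers[of f] by (auto simp: in_cyclic_subgroup_def)
  then obtain m g where m: "s = f # m @ [g]" using s' by (cases s' rule: rev_cases) auto
  have car: "f \<in> carrier G" "g \<in> carrier G" "set m \<subseteq> carrier G" using s m by auto
  have sA: "s = (f # m) @ [g]" and sB: "s = f # (m @ [g])" using m by auto
  have pf: "product_one_free G (f # m)" "product_one_free G (m @ [g])"
    using product_one_free_snoc[of "f # m" g] product_one_free_Cons[of "m @ [g]" f] s car m by auto
  define A where "A = products G s"
  have pre: "\<not> in_cyclic_subgroup (set (f # m))"
    using card_products_cyclic_snoc[of "f # m" g] s car pf unfolding sA by auto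
  have suf: "\<not> in_cyclic_subgroup (set (m @ [g]))"
    using card_products_cyclic_Cons[of "m @ [g]" f] s car pf unfolding sB by auto
  have cpre: "2 * length (f # m) \<le> card (products G (f # m))"
    using minimal[of "f # m"] pre pf car m unfolding small_products_def by auto
  have csuf: "2 * length (m @ [g]) \<le> card (products G (m @ [g]))"
    using minimal[of "m @ [g]"] suf pf car m unfolding small_products_def by auto
  have "card (products G (f # m)) < card A"
    using products_snoc_strict[of "f # m" g] car s unfolding A_def sA by simp
  \<comment> \<open>By minimality the shorter sequence has at least
    \<open>2 * (length s - 1)\<close> subproducts. As \<open>A\<close> is strictly larger but has
    fewer than \<open>2 * length s\<close> elements, one value remains.\<close>
  then have cA: "Suc (card A) = 2 * length s" using cpre s m unfolding A_def by simp
  then have odd: "odd (card A)" by (metis dvd_triv_left even_Suc)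
  have Acar: "A \<subseteq> carrier G" using products_closed s unfolding A_def by blast
  have "card A \<le> Suc (card (products G (f # m)))" using cA cpre m by simp
  then obtain T where T: "initial_run A g T" and right: "\<And>x. x \<in> A \<Longrightarrow> x \<notin> powers g \<Longrightarrow> x \<otimes> g \<in> A"
    using products_snoc_run[of "f # m" g] car s unfolding A_def sA by auto
  have "card A \<le> Suc (card (products G (m @ [g])))" using cA csuf m by simp
  then obtain S where S: "initial_run A f S" and left: "\<And>x. x \<in> A \<Longrightarrow> x \<notin> powers f \<Longrightarrow> f \<otimes> x \<in> A"
    using products_Cons_run[of "m @ [g]" f] car s unfolding A_def sB by auto
  have "f \<noteq> \<one>" "g \<noteq> \<one>" using S T by (auto simp: initial_run_def)
  then have ends: "f = g \<or> inv f \<in> A \<and> inv g \<in> A"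
    using ends_of_runs[OF Acar _ _ _ _ S T left right] car by blast
  \<comment> \<open>Once \<open>inv f\<close> is in \<open>A\<close>, all of \<open>powers f\<close>
    is, which fills the gap left by \<open>left\<close>.\<close>
  have leftc: "f \<otimes> x \<in> A" if "inv f \<in> A" "x \<in> A" for x
  proof (cases "x \<in> powers f")
    case True
    then have "f \<otimes> x \<in> powers f"
      using subgroup.m_closed[OF subgroup_powers[OF car(1)]] self_in_powers[OF car(1)] by blast
    then show ?thesis using initial_run_full[OF car(1) S that(1)] by blast
  qed (use left that in blast)
  have rightc: "x \<otimes> g \<in> A" if "inv g \<in> A" "x \<in> A" for x
  proof (cases "x \<in> powers g")
    case True
    then have "x \<otimes> g \<in> powers g"
      using subgroup.m_closed[OF subgroup_powers[OF car(2)]] self_in_powers[OF car(2)] by blast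
    then show ?thesis using initial_run_full[OF car(2) T that(1)] by blast
  qed (use right that in blast)
  have "g \<in> powers y" if "inv g \<in> A"
    using even_card_right_mult[OF Acar car(2) \<open>g \<noteq> \<one>\<close> torsion[OF car(2)] rightc[OF that]] odd by blast
  then have "last s \<notin> powers y \<longrightarrow> hd s = last s" using ends m by auto
  \<comment> \<open>The rotation unites \<open>products G (m @ [g])\<close> with its right instead
    of its left translate by \<open>f\<close>, so that right translate must be placed inside
    \<open>A\<close>.\<close>
  moreover have "products G (rotate1 s) \<subseteq> A"
  proof -
    have sub: "products G (m @ [g]) \<subseteq> A" unfolding A_def sB products_Cons[OF car(1)] by blast
    have fsub: "f \<otimes> x \<in> A" if "x \<in> products G (m @ [g])" for x
      using that unfolding A_def sB products_Cons[OF car(1)] by blast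
    have "x \<otimes> f \<in> A" if x: "x \<in> products G (m @ [g])" for x
    proof -
      have xA: "x \<in> A" and xc: "x \<in> carrier G" using x sub Acar by auto
      show ?thesis
      proof (cases "f = g")
        case True
        show ?thesis
        proof (cases "x \<in> powers f")
          case True
          then obtain i :: nat where "x = f [^] i" by (rule rangeE)
          then have "x \<otimes> f = f \<otimes> x" using nat_pow_Suc2[OF car(1), of i] by simp
          then show ?thesis using fsub x by simp
        qed (use True right xA in blast)
      next
        case False
        then have fA: "inv f \<in> A" using ends by blast
        then have "f \<in> powers y"
          using even_card_left_mult[OF Acar car(1) \<open>f \<noteq> \<one>\<close> torsion[OF car(1)] leftc] odd by blast
        \<comment> \<open>Moved to the left of \<open>x\<close>, the factor \<open>f\<close> becomes
          a power of \<open>f\<close>, under which \<open>A\<close> is invariant.\<close>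
        then obtain j :: nat where j: "x \<otimes> f = f [^] j \<otimes> x" using conj xc by blast
        have "f [^] j \<otimes> x \<in> A" for j :: nat
        proof (induction j)
          case (Suc j)
          have "f [^] Suc j \<otimes> x = f \<otimes> (f [^] j \<otimes> x)"
            using nat_pow_Suc2[OF car(1), of j] car xc by (simp add: m_assoc del: nat_pow_Suc)
          then show ?case using leftc[OF fA] Suc.IH by simp
        qed (use xA xc in simp)
        then show ?thesis using j by simp
      qed
    qed
    then show ?thesis using sub m car by (auto simp: products_snoc simp flip: append_assoc)
  qed
  then have "card (products G (rotate1 s)) \<le> card A"
    unfolding A_def by (intro card_mono) auto
  then have "small_products (rotate1 s)"
    using s product_one_free_rotate[of "[f]" "m @ [g]"] car m
    unfolding small_products_def A_def by (simp add: insert_commute)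
  ultimately show ?thesis by blast
qed

theorem card_products_noncyclic:
  assumes y: "y \<in> carrier G"
    and conj: "\<And>c x. c \<in> powers y \<Longrightarrow> x \<in> carrier G \<Longrightarrow> \<exists>j::nat. x \<otimes> c = c [^] j \<otimes> x"
    and torsion: "\<And>x. x \<in> carrier G \<Longrightarrow> x \<notin> powers y \<Longrightarrow> x [^] (4::nat) = \<one>"
    and s: "set s \<subseteq> carrier G" "product_one_free G s" "\<not> in_cyclic_subgroup (set s)"
  shows "2 * length s \<le> card (products G s)"
proof -
  have "\<not> small_products s" for s
  proof (induction s rule: measure_induct_rule[where f = length])
    case (less s)
    show ?case
    proof
      assume small: "small_products s"
      have step: "small_products (rotate1 u) \<and> (last u \<notin> powers y \<longrightarrow> hd u = last u)"
        if "small_products u" "length u = length s" for u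
        using minimal_small_products_rotate[OF y conj torsion that(1)] less that(2) by metis
      have rot: "small_products (rotate i s)" for i
        by (induction i) (use small step in auto)
      have "\<not> set s \<subseteq> powers y" using small y by (auto simp: small_products_def in_cyclic_subgroup_def)
      then obtain k where k: "k < length s" "s ! k \<notin> powers y" by (metis in_set_conv_nth subsetI)
      define t where "t = s ! k"
      \<comment> \<open>This rotation brings the term \<open>s ! k\<close>, which is outside
        \<open>powers y\<close>, to the end.\<close>
      define u where "u = rotate (Suc k) s"
      have ne: "rotate i s \<noteq> []" for i using k by auto
      have hl: "last (rotate1 v) = hd v" if "v \<noteq> []" for v :: "'a list"
        using that by (cases v) auto
      have "last u = t"
        using hl[OF ne[of k]] hd_rotate_conv_nth[of s k] k ne[of 0] by (auto simp: u_def t_def)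
      have rotu: "small_products (rotate i u)" for i
        using rot[of "i + Suc k"] by (simp add: u_def rotate_rotate del: rotate_Suc)
      have neu: "rotate i u \<noteq> []" for i using ne by (simp add: u_def)
      have hdlast: "hd (rotate i u) = last (rotate i u)" if "last (rotate i u) = t" for i
        using step[OF rotu[of i]] that k(2) by (simp add: t_def u_def)
      \<comment> \<open>While the last term is \<open>t\<close>, so is the head, and rotating moves
        that head to the end. Every term of \<open>u\<close> is the head of some rotation, hence
        equals \<open>t\<close>.\<close>
      have last: "last (rotate i u) = t" for i
      proof (induction i)
        case (Suc i)
        then show ?case using hl[OF neu[of i]] hdlast[of i] by simp
      qed (use \<open>last u = t\<close> in simp)
      have "u ! i = t" if "i < length u" for i
        using hd_rotate_conv_nth[of u i] hdlast[OF last[of i]] last[of i] that by (cases "u = []") auto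
      then have "set u \<subseteq> {t}" by (auto simp: in_set_conv_nth)
      then have "set s \<subseteq> {t}" by (simp add: u_def del: rotate_Suc)
      moreover have "t \<in> carrier G"
        using k(1) small nth_mem unfolding t_def small_products_def by blast
      ultimately show False
        using small self_in_powers[of t] unfolding small_products_def in_cyclic_subgroup_def by blast
    qed
  qed
  then show ?thesis using s unfolding small_products_def by (metis not_less)
qed

end

end

section \<open>Groups with a cyclic subgroup of index two\<close>

context group
begin

lemma nonempty_products_replicate:
  "y \<in> carrier G \<Longrightarrow> nonempty_products G (replicate j y) \<subseteq> (\<lambda>i. y [^] i) ` {1..j}"
proof (induction j)
  case (Suc j)
  have "y [^] (1::nat) \<in> (\<lambda>i. y [^] i) ` {1..Suc j}" by (intro imageI) simp
  then have "y \<in> (\<lambda>i. y [^] i) ` {1..Suc j}" using Suc.prems by simp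
  moreover have "(\<lambda>i. y [^] i) ` {1..j} \<subseteq> (\<lambda>i. y [^] i) ` {1..Suc j}" by auto
  moreover have "(\<lambda>a. y \<otimes> a) ` (\<lambda>i. y [^] i) ` {1..j} \<subseteq> (\<lambda>i. y [^] i) ` {1..Suc j}"
  proof clarify
    fix i assume "i \<in> {1..j}"
    then show "y \<otimes> y [^] i \<in> (\<lambda>i. y [^] i) ` {1..Suc j}"
      using nat_pow_Suc2[OF Suc.prems, of i] by (intro image_eqI[of _ _ "Suc i"]) auto
  qed
  moreover have IH: "nonempty_products G (replicate j y) \<subseteq> (\<lambda>i. y [^] i) ` {1..j}"
    using Suc by simp
  note image_mono[OF IH, of "\<lambda>a. y \<otimes> a"]
  ultimately show ?case using IH
    unfolding replicate_Suc nonempty_products.simps insert_subset Un_subset_iff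
    by (intro conjI) (assumption | rule subset_trans)+
qed simp

text \<open>Prefixes of a product-one free sequence are product-one free, so \<open>w\<close>
  excludes every positive length up to \<open>m\<close>.\<close>

lemma ordered_davenport_eqI:
  assumes long: "\<And>s. length s = Suc m \<Longrightarrow> set s \<subseteq> carrier G \<Longrightarrow> \<not> product_one_free G s"
    and w: "length w = m" "set w \<subseteq> carrier G" "product_one_free G w"
  shows "ordered_davenport G = Suc m"
  unfolding ordered_davenport_def
proof (rule Least_equality)
  show "0 < Suc m \<and> (\<forall>g. length g = Suc m \<and> set g \<subseteq> carrier G \<longrightarrow> has_ordered_product_one_subsequence G g)"
    using long has_ordered_product_one_subsequence_iff[OF is_group] by blast
next
  fix k
  assume k: "0 < k \<and> (\<forall>g. length g = k \<and> set g \<subseteq> carrier G \<longrightarrow> has_ordered_product_one_subsequence G g)"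
  show "Suc m \<le> k"
  proof (rule ccontr)
    assume "\<not> Suc m \<le> k"
    moreover have sub: "set (take k w) \<subseteq> carrier G" "set (drop k w) \<subseteq> carrier G"
      using w(2) set_take_subset[of k w] set_drop_subset[of k w] by auto
    ultimately have "\<not> product_one_free G (take k w)"
      using k w(1) has_ordered_product_one_subsequence_iff[OF is_group sub(1)] by simp
    moreover have "product_one_free G (take k w)"
      using w(3) nonempty_products_append[OF sub] unfolding product_one_free_def by simp
    ultimately show False by blast
  qed
qed

text \<open>A product-one free sequence of length \<open>Suc m\<close> would have at least
  \<open>2 * m + 2\<close> subproducts if noncyclic, more than the order of \<open>G\<close>. If
  cyclic it would have more than \<open>m\<close>, but by \<open>4 \<le> m\<close> every element has
  order at most \<open>m\<close>.\<close>

lemma ordered_davenport_metacyclic: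
  fixes m r s :: nat
  assumes xy: "x \<in> carrier G" "y \<in> carrier G" and m: "4 \<le> m"
    and ym: "y [^] m = \<one>" and xx: "x \<otimes> x = y [^] s" and yx: "y \<otimes> x = x \<otimes> y [^] r"
    and gen: "carrier G = powers y \<union> (\<lambda>c. x \<otimes> c) ` powers y"
    and order: "order G = 2 * m"
    and arith: "m dvd 2 * s" "m dvd 2 * (r + 1)" "r * r mod m = 1"
  shows "ordered_davenport G = Suc m"
proof (rule ordered_davenport_eqI)
  have fin: "finite (carrier G)" using order m by (auto simp: order_def intro: card_ge_0_finite)
  have ydvd: "y [^] i = \<one>" if dv: "m dvd i" for i
  proof -
    obtain k where "i = m * k" using dv by (rule dvdE)
    then show ?thesis using ym xy by (simp flip: nat_pow_pow)
  qed
  note yix = pow_mult_twist[OF xy yx]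
  have card_powers: "card (powers y) \<le> ord y"
  proof -
    have "powers y \<subseteq> (\<lambda>i. y [^] i) ` {..<ord y}" using powers_lessE[OF fin xy(2)] by blast
    then show ?thesis using surj_card_le[of "{..<ord y}"] by simp
  qed
  have ordm: "ord y \<le> m" using ym xy m by (auto simp: pow_eq_id intro: dvd_imp_le)
  \<comment> \<open>Two cosets of \<open>powers y\<close> must cover \<open>2 * m\<close> elements,
    so \<open>ord y\<close> cannot be less than \<open>m\<close>.\<close>
  have "2 * m \<le> card (powers y) + card ((\<lambda>c. x \<otimes> c) ` powers y)"
    using order card_Un_le[of "powers y" "(\<lambda>c. x \<otimes> c) ` powers y"] gen by (simp add: order_def)
  moreover have finp: "finite (powers y)" using fin gen by simp
  have "card ((\<lambda>c. x \<otimes> c) ` powers y) \<le> card (powers y)" using finp by (rule card_image_le)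
  ultimately have ordy: "ord y = m" using card_powers ordm by linarith
  interpret P: subgroup "powers y" G using subgroup_powers[OF fin xy(2)] .
  have xn: "x \<notin> powers y"
  proof
    assume "x \<in> powers y"
    then have "carrier G \<subseteq> powers y" unfolding gen by auto
    then have "card (carrier G) \<le> card (powers y)" using finp card_mono by blast
    then show False using order card_powers ordm m by (simp add: order_def)
  qed
  have coset: "\<exists>i::nat. z = x \<otimes> y [^] i" if "z \<in> carrier G" "z \<notin> powers y" for z
    using that gen by auto
  have torsion: "z [^] (4::nat) = \<one>" if "z \<in> carrier G" "z \<notin> powers y" for z
  proof -
    obtain i :: nat where i: "z = x \<otimes> y [^] i" using coset \<open>z \<in> carrier G\<close> \<open>z \<notin> powers y\<close> by blast
    \<comment> \<open>The square of \<open>z\<close> is a power of \<open>y\<close> whose exponent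
      becomes divisible by \<open>m\<close> when doubled.\<close>
    have "z \<otimes> z = x \<otimes> (y [^] i \<otimes> x) \<otimes> y [^] i" using xy unfolding i by (simp add: m_assoc)
    also have "\<dots> = (x \<otimes> x) \<otimes> (y [^] (r * i) \<otimes> y [^] i)" using xy unfolding yix by (simp add: m_assoc)
    also have "\<dots> = y [^] (s + (r + 1) * i)" using xy by (simp add: xx nat_pow_mult algebra_simps)
    finally have zz: "z \<otimes> z = y [^] (s + (r + 1) * i)" .
    have "s + (r + 1) * i + (s + (r + 1) * i) = 2 * s + 2 * (r + 1) * i" by (simp add: algebra_simps)
    then have "(z \<otimes> z) \<otimes> (z \<otimes> z) = y [^] (2 * s + 2 * (r + 1) * i)"
      using xy(2) unfolding zz by (simp only: nat_pow_mult)
    also have "\<dots> = \<one>" using ydvd[OF dvd_add[OF arith(1) dvd_mult2[OF arith(2)]]] .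
    finally have "(z \<otimes> z) \<otimes> (z \<otimes> z) = \<one>" .
    then show ?thesis using that pow_four[of z] by (simp add: m_assoc)
  qed
  have conj: "\<exists>j::nat. z \<otimes> c = c [^] j \<otimes> z" if c: "c \<in> powers y" and z: "z \<in> carrier G" for c z
  proof -
    obtain a :: nat where a: "c = y [^] a" using c by (rule rangeE)
    show ?thesis
    proof (cases "z \<in> powers y")
      case True
      then obtain i :: nat where i: "z = y [^] i" by (rule rangeE)
      have "z \<otimes> c = c [^] (1::nat) \<otimes> z" using xy unfolding i a by (simp add: nat_pow_mult add.commute)
      then show ?thesis by blast
    next
      case False
      then obtain i :: nat where i: "z = x \<otimes> y [^] i" using coset z by blast
      have rr: "y [^] (r * r) = y"
      proof -
        have "r * r = m * (r * r div m) + 1" using arith(3) mult_div_mod_eq[of m "r * r"] by simp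
        then have "y [^] (r * r) = y [^] (m * (r * r div m)) \<otimes> y" using xy by (metis nat_pow_Suc Suc_eq_plus1)
        then show ?thesis using ydvd[of "m * (r * r div m)"] xy by simp
      qed
      \<comment> \<open>The witness is \<open>r\<close>: passing \<open>x\<close> multiplies
        exponents of \<open>y\<close> by \<open>r\<close>, and \<open>r * r\<close> is 1 modulo
        \<open>m\<close>.\<close>
      have "c [^] r \<otimes> z = (y [^] (a * r) \<otimes> x) \<otimes> y [^] i" using xy unfolding i a by (simp add: nat_pow_pow m_assoc)
      also have "\<dots> = x \<otimes> (y [^] (r * r)) [^] a \<otimes> y [^] i" unfolding yix using xy by (simp add: nat_pow_pow mult_ac)
      also have "\<dots> = z \<otimes> c" using xy unfolding rr i a by (simp add: m_assoc nat_pow_mult add.commute)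
      finally show ?thesis by metis
    qed
  qed
  show "\<not> product_one_free G s" if s: "length s = Suc m" "set s \<subseteq> carrier G" for s
  proof
    assume pf: "product_one_free G s"
    show False
    proof (cases "in_cyclic_subgroup (set s)")
      case True
      then obtain z where z: "z \<in> carrier G" "set s \<subseteq> powers z" by (auto simp: in_cyclic_subgroup_def)
      have "z [^] m = \<one> \<or> z [^] (4::nat) = \<one>"
      proof (cases "z \<in> powers y")
        case True
        then obtain i :: nat where "z = y [^] i" by (rule rangeE)
        then show ?thesis using xy ydvd by (simp add: nat_pow_pow)
      qed (use torsion z in blast)
      then have "ord z \<le> m" using z m by (auto simp: pow_eq_id dest: dvd_imp_le)
      moreover have "powers z \<subseteq> (\<lambda>i. z [^] i) ` {..<ord z}" using powers_lessE[OF fin z(1)] by blast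
      then have "products G s \<subseteq> (\<lambda>i. z [^] i) ` {..<ord z}" using products_in_powers[OF fin z] by blast
      then have "card (products G s) \<le> ord z" using surj_card_le[of "{..<ord z}"] by simp
      ultimately show False using card_products_ge[OF s(2) pf] s(1) by simp
    next
      case False
      then have "2 * length s \<le> card (products G s)"
        using card_products_noncyclic[OF fin xy(2) conj torsion s(2) pf] by blast
      moreover have "card (products G s) \<le> card (carrier G)" using products_closed[OF s(2)] fin card_mono by blast
      ultimately show False using s(1) order by (simp add: order_def)
    qed
  qed
  \<comment> \<open>Products of the \<open>y\<close> terms alone are powers with exponents from 1 to
    \<open>m - 1\<close>, and any product using \<open>x\<close> is outside
    \<open>powers y\<close>.\<close>
  let ?w = "replicate (m - 1) y @ [x]"
  show "length ?w = m" "set ?w \<subseteq> carrier G" using m xy by auto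
  show "product_one_free G ?w"
  proof (subst product_one_free_snoc)
    have "\<one> \<notin> (\<lambda>i. y [^] i) ` {1..m - 1}"
      using pow_eq_id[OF xy(2)] ordy m by (auto simp: eq_commute[of \<one>] dest!: dvd_imp_le)
    then have "product_one_free G (replicate (m - 1) y)"
      using nonempty_products_replicate[OF xy(2), of "m - 1"] unfolding product_one_free_def by blast
    moreover have "inv x \<notin> products G (replicate (m - 1) y)"
    proof
      assume "inv x \<in> products G (replicate (m - 1) y)"
      moreover have "set (replicate (m - 1) y) \<subseteq> powers y"
        using self_in_powers[OF fin xy(2)] by (metis in_set_replicate subsetI)
      then have "products G (replicate (m - 1) y) \<subseteq> powers y" by (rule products_in_powers[OF fin xy(2)])
      ultimately have "inv x \<in> powers y" by blast
      then show False using xn P.m_inv_closed[of "inv x"] xy by simp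
    qed
    ultimately show "product_one_free G (replicate (m - 1) y) \<and> inv x \<notin> products G (replicate (m - 1) y)" ..
  qed (use xy in auto)
qed

end

section \<open>The presentations\<close>

text \<open>The isomorphism becomes an evaluation of words in \<open>G\<close> whose fibres are the
  classes of \<open>word_eq\<close>, so relations turn into equations in \<open>G\<close> and
  back.\<close>

lemma presentation_surjection:
  assumes G: "group G" and iso: "G \<cong> presented_group R"
  obtains ev where "\<And>u. ev u \<in> carrier G" "\<And>u w. ev (u @ w) = ev u \<otimes>\<^bsub>G\<^esub> ev w"
    "\<And>u w. ev u = ev w \<longleftrightarrow> word_eq R u w" "carrier G = range ev"
proof -
  obtain h where h: "h \<in> iso (presented_group R) G"
    using group.iso_sym[OF G iso] by (auto simp: is_iso_def)
  define K where "K u = {w. word_eq R u w}" for u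
  have hb: "h \<in> hom (presented_group R) G" "bij_betw h (carrier (presented_group R)) (carrier G)"
    using h by (auto simp: iso_def)
  have carK: "carrier (presented_group R) = range K"
    using presented_group_carrier_iff[of _ R] by (auto simp: K_def)
  have Keq: "K u = K w \<longleftrightarrow> word_eq R u w" for u w
    unfolding K_def using word_eq.refl[of R w] by (blast intro: word_eq.trans word_eq.sym)
  show thesis
  proof (rule that[of "\<lambda>u. h (K u)"])
    show "carrier G = range (\<lambda>u. h (K u))"
      using bij_betw_imp_surj_on[OF hb(2)] carK by (auto simp: image_image)
    then show "h (K u) \<in> carrier G" for u by blast
    show "h (K (u @ w)) = h (K u) \<otimes>\<^bsub>G\<^esub> h (K w)" for u w
      using hom_mult[OF hb(1), of "K u" "K w"] carK presented_group_mult[of R u w] by (simp add: K_def)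
    show "h (K u) = h (K w) \<longleftrightarrow> word_eq R u w" for u w
      using inj_on_eq_iff[OF bij_betw_imp_inj_on[OF hb(2)], of "K u" "K w"] carK Keq rangeI by metis
  qed
qed

text \<open>
  Right multiplication on the normal forms \<open>x\<^sup>e y\<^sup>a\<close>, with \<open>a\<close> modulo \<open>m\<close>, in the group with
  \<open>x\<^sup>2 = y\<^sup>s\<close> and \<open>x\<^sup>-\<^sup>1 y x = y\<^sup>r\<close>. It separates the normal forms, which bounds the order of the
  presented group from below.
\<close>

fun metacyclic_act :: "nat \<Rightarrow> nat \<Rightarrow> nat \<Rightarrow> gen letter \<Rightarrow> bool \<times> int \<Rightarrow> bool \<times> int" where
  "metacyclic_act m r s (Gen gen_y) (e, a) = (e, (a + 1) mod int m)"
| "metacyclic_act m r s (GenInv gen_y) (e, a) = (e, (a - 1) mod int m)"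
| "metacyclic_act m r s (Gen gen_x) (e, a) =
     (if e then (False, (int r * a + int s) mod int m) else (True, int r * a mod int m))"
| "metacyclic_act m r s (GenInv gen_x) (e, a) =
     (if e then (False, int r * a mod int m) else (True, int r * (a - int s) mod int m))"

text \<open>A common shape for both families. The word \<open>v\<close> is a parameter because the
  dicyclic relation has an inverse letter where the semi-dihedral one has a power of
  \<open>y\<close>.\<close>

definition metacyclic_relations :: "nat \<Rightarrow> nat \<Rightarrow> gen word \<Rightarrow> (gen word \<times> gen word) set" where
  "metacyclic_relations m s v =
     {(replicate 2 (Gen gen_x), replicate s (Gen gen_y)),
      (replicate m (Gen gen_y), []),
      ([GenInv gen_x, Gen gen_y, Gen gen_x], v)}"

context
  fixes m r s :: nat and v :: "gen word"
  assumes rr: "r * r mod m = 1" and rs: "r * s mod m = s mod m"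
    and v: "v = replicate r (Gen gen_y) \<or> v = [GenInv gen_y] \<and> Suc r = m"
begin

abbreviation act :: "gen letter \<Rightarrow> bool \<times> int \<Rightarrow> bool \<times> int" where
  "act \<equiv> metacyclic_act m r s"

text \<open>These rules compute the action on unreduced representatives of residues, which is why
  later states are written with \<open>a mod int m\<close>.\<close>

lemma act_mod:
  "act (Gen gen_y) (e, a mod int m) = (e, (a + 1) mod int m)"
  "act (GenInv gen_y) (e, a mod int m) = (e, (a - 1) mod int m)"
  "act (Gen gen_x) (False, a mod int m) = (True, int r * a mod int m)"
  "act (Gen gen_x) (True, a mod int m) = (False, (int r * a + int s) mod int m)"
  "act (GenInv gen_x) (True, a mod int m) = (False, int r * a mod int m)"
  "act (GenInv gen_x) (False, a mod int m) = (True, int r * (a - int s) mod int m)"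
proof -
  have "int r * (a mod int m - int s) mod int m = int r * ((a mod int m - int s) mod int m) mod int m"
    by (simp only: mod_mult_right_eq)
  also have "\<dots> = int r * (a - int s) mod int m"
    by (simp only: mod_diff_left_eq mod_mult_right_eq)
  finally show "act (GenInv gen_x) (False, a mod int m) = (True, int r * (a - int s) mod int m)" by simp
  have "(int r * (a mod int m) + int s) mod int m = (int r * a + int s) mod int m"
    by (metis mod_add_left_eq mod_mult_right_eq)
  then show "act (Gen gen_x) (True, a mod int m) = (False, (int r * a + int s) mod int m)" by simp
qed (simp_all add: mod_simps)

lemma act_normalized: "\<exists>e' b. act l (e, a) = (e', b mod int m)"
  by (cases l; rename_tac g; case_tac g) auto

declare metacyclic_act.simps [simp del] fold_replicate [simp del]

lemma act_word_normalized: "\<exists>e' b. fold act u (e, a mod int m) = (e', b mod int m)"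
proof (induction u arbitrary: e a)
  case (Cons l u)
  then show ?case using act_normalized[of l e "a mod int m"] by auto
qed auto

lemma act_replicate_y:
  "fold act (replicate k (Gen gen_y)) (e, a mod int m) = (e, (a + int k) mod int m)"
proof (induction k arbitrary: a)
  case (Suc k)
  then show ?case using Suc.IH[of "a + 1"] by (simp add: act_mod ac_simps)
qed simp

lemma int_rr: "(int r * (int r * a) + b) mod int m = (a + b) mod int m"
proof -
  have "int (r * r) mod int m = 1" using rr by (metis of_nat_1 zmod_int)
  then have "(int r * int r) mod int m * a mod int m = a mod int m" by simp
  then have "int r * (int r * a) mod int m = a mod int m" by (simp add: mod_simps mult.assoc)
  then show ?thesis by (metis mod_add_left_eq)
qed

lemma int_rs: "(a + int r * int s) mod int m = (a + int s) mod int m"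
proof -
  have "int r * int s mod int m = int s mod int m" using rs by (metis of_nat_mult zmod_int)
  then show ?thesis by (metis mod_add_right_eq)
qed

text \<open>Acting twice with \<open>x\<close> must add \<open>s\<close>: starting from
  \<open>False\<close> this needs \<open>r * r\<close> to be 1 modulo \<open>m\<close>, and starting
  from \<open>True\<close> also \<open>rs\<close>.\<close>

lemma act_relation:
  assumes "(p, q) \<in> metacyclic_relations m s v"
  shows "fold act p (e, a mod int m) = fold act q (e, a mod int m)"
proof -
  have v: "fold act v (e, a mod int m) = (e, (a + int r) mod int m)"
    using v
  proof
    assume "v = [GenInv gen_y] \<and> Suc r = m"
    moreover from this have "a + int r = (a - 1) + int m" by auto
    then have "(a + int r) mod int m = (a - 1) mod int m" by (metis mod_add_self2)
    ultimately show ?thesis by (simp add: act_mod)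
  qed (simp add: act_replicate_y)
  consider "p = replicate 2 (Gen gen_x)" "q = replicate s (Gen gen_y)"
    | "p = replicate m (Gen gen_y)" "q = []"
    | "p = [GenInv gen_x, Gen gen_y, Gen gen_x]" "q = v"
    using assms by (auto simp: metacyclic_relations_def)
  then show ?thesis
  proof cases
    case 1
    then show ?thesis using int_rr[of a "int s"] int_rr[of a "int r * int s"] int_rs[of a]
      by (cases e) (auto simp: act_mod act_replicate_y numeral_2_eq_2 distrib_left) 
  next
    case 2
    then show ?thesis by (simp add: act_replicate_y)
  next
    case 3
    have "(int r * (int r * (a - int s) + 1) + int s) mod int m = (a + int r) mod int m"
      using int_rr[of "a - int s" "int r + int s"] by (simp add: distrib_left add.assoc)
    then show ?thesis unfolding 3 v using int_rr[of a "int r"]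
      by (cases e) (simp_all add: act_mod distrib_left)
  qed
qed

lemma act_cancel:
  "fold act [Gen g, GenInv g] (e, a mod int m) = (e, a mod int m)"
  "fold act [GenInv g, Gen g] (e, a mod int m) = (e, a mod int m)"
proof -
  have "(int r * (int r * (a - int s)) + int s) mod int m = a mod int m"
    using int_rr[of "a - int s" "int s"] by simp
  then show "fold act [Gen g, GenInv g] (e, a mod int m) = (e, a mod int m)"
    "fold act [GenInv g, Gen g] (e, a mod int m) = (e, a mod int m)"
    using int_rr[of a 0] by (cases g; cases e; simp add: act_mod)+
qed

text \<open>Words act from the left end on, and any prefix leads to a reduced state, where
  \<open>act_relation\<close> and \<open>act_cancel\<close> apply.\<close>

lemma act_word_eq:
  assumes "word_eq (metacyclic_relations m s v) p q"
  shows "fold act p (e, a mod int m) = fold act q (e, a mod int m)"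
  using assms
proof (induction arbitrary: e a rule: word_eq.induct)
  case (cancel u g w)
  then show ?case using act_word_normalized[of u e a] act_cancel(1)[of g] by (auto)
next
  case (cancel' u g w)
  then show ?case using act_word_normalized[of u e a] act_cancel(2)[of g] by (auto)
next
  case (relation p q u w)
  then show ?case using act_word_normalized[of u e a] act_relation[of p q] by (auto)
qed auto

text \<open>Different normal forms thus move \<open>(False, 0)\<close> to different states, so the
  presentation does not identify them.\<close>

lemma act_normal_form:
  assumes "k < m"
  shows "fold act ((if b then [Gen gen_x] else []) @ replicate k (Gen gen_y)) (False, 0) = (b, int k)"
  using act_replicate_y[of k b 0] act_mod(3)[of 0] assms by (cases b) simp_all

lemma metacyclic_presentation:
  fixes G :: "('a, 'b) monoid_scheme" (structure)
  assumes G: "group G" and iso: "G \<cong> presented_group (metacyclic_relations m s v)"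
    and m: "4 \<le> m" and arith: "m dvd 2 * s" "m dvd 2 * (r + 1)"
  shows "order G = 2 * m" "ordered_davenport G = Suc m"
proof -
  interpret group G by fact
  let ?R = "metacyclic_relations m s v"
  obtain ev where ev: "\<And>u. ev u \<in> carrier G" "\<And>u w. ev (u @ w) = ev u \<otimes> ev w"
    "\<And>u w. ev u = ev w \<longleftrightarrow> word_eq ?R u w" and range: "carrier G = range ev"
    using presentation_surjection[OF G iso] by metis
  define x where "x = ev [Gen gen_x]"
  define y where "y = ev [Gen gen_y]"
  have xy: "x \<in> carrier G" "y \<in> carrier G" using ev(1) by (auto simp: x_def y_def)
  have nil: "ev [] = \<one>" using ev(2)[of "[]" "[]"] ev(1)[of "[]"] by simp
  have cons: "ev (l # u) = ev [l] \<otimes> ev u" for l u using ev(2)[of "[l]" u] by simp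
  have rep: "ev (replicate k (Gen gen_y)) = y [^] k" for k
    by (induction k) (use nil xy cons[of "Gen gen_y"] nat_pow_Suc2[OF xy(2)] in
        \<open>auto simp: y_def[symmetric] simp del: nat_pow_Suc\<close>)
  have ginv: "ev [GenInv g] = inv (ev [Gen g])" for g
  proof -
    have "ev [GenInv g, Gen g] = ev []" using ev(3) word_eq.cancel'[of ?R "[]" g "[]"] by simp
    then have "ev [GenInv g] \<otimes> ev [Gen g] = \<one>" using cons[of "GenInv g" "[Gen g]"] nil by simp
    then show ?thesis using inv_equality ev(1) by metis
  qed
  have rel: "ev p = ev q" if "(p, q) \<in> ?R" for p q
    using ev(3) word_eq.relation[OF that, of "[]" "[]"] by simp
  have xx: "x \<otimes> x = y [^] s"
    using rel[of "replicate 2 (Gen gen_x)" "replicate s (Gen gen_y)"] cons[of "Gen gen_x" "[Gen gen_x]"]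
    by (simp add: metacyclic_relations_def rep numeral_2_eq_2 x_def)
  have ym: "y [^] m = \<one>"
    using rel[of "replicate m (Gen gen_y)" "[]"] by (simp add: metacyclic_relations_def rep nil)
  have "ev v = y [^] r"
    using v
  proof
    assume *: "v = [GenInv gen_y] \<and> Suc r = m"
    then have "y [^] r \<otimes> y = \<one>" using ym nat_pow_Suc by metis
    then show ?thesis using * ginv inv_equality xy by (simp add: y_def)
  qed (simp add: rep)
  moreover have "ev [GenInv gen_x, Gen gen_y, Gen gen_x] = inv x \<otimes> (y \<otimes> x)"
    using cons[of "GenInv gen_x" "[Gen gen_y, Gen gen_x]"] cons[of "Gen gen_y" "[Gen gen_x]"] ginv
    by (simp add: x_def y_def)
  ultimately have "inv x \<otimes> (y \<otimes> x) = y [^] r"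
    using rel[of "[GenInv gen_x, Gen gen_y, Gen gen_x]" v] by (simp add: metacyclic_relations_def)
  then have yx: "y \<otimes> x = x \<otimes> y [^] r" using xy by (metis inv_solve_left m_closed nat_pow_closed)
  \<comment> \<open>The values of the normal forms. Closure under right multiplication by all
    letters will show that they exhaust \<open>G\<close>.\<close>
  define C where "C = powers y \<union> (\<lambda>c. x \<otimes> c) ` powers y"
  note yix = pow_mult_twist[OF xy yx]
  have C1: "y [^] i \<in> C" and C2: "x \<otimes> y [^] i \<in> C" for i :: nat by (auto simp: C_def)
  have CE: "P z" if "z \<in> C" "\<And>i::nat. P (y [^] i)" "\<And>i::nat. P (x \<otimes> y [^] i)" for P z
    using that by (auto simp: C_def)
  have Cy: "z \<otimes> y \<in> C" if "z \<in> C" for z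
  proof (rule CE[OF that])
    show "y [^] i \<otimes> y \<in> C" for i :: nat using C1[of "Suc i"] by simp
    show "x \<otimes> y [^] i \<otimes> y \<in> C" for i :: nat using C2[of "Suc i"] xy by (simp add: m_assoc)
  qed
  have Cx: "z \<otimes> x \<in> C" if "z \<in> C" for z
  proof (rule CE[OF that])
    show "y [^] i \<otimes> x \<in> C" for i :: nat unfolding yix by (rule C2)
    have "x \<otimes> y [^] i \<otimes> x = x \<otimes> (y [^] i \<otimes> x)" for i :: nat using xy by (simp add: m_assoc)
    also have "\<dots> i = (x \<otimes> x) \<otimes> y [^] (r * i)" for i :: nat unfolding yix using xy by (simp add: m_assoc)
    finally show "x \<otimes> y [^] i \<otimes> x \<in> C" for i :: nat
      using C1[of "s + r * i"] xy by (simp add: xx nat_pow_mult)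
  qed
  have Cpow: "z \<otimes> g [^] k \<in> C" if "z \<in> C" "g \<in> {x, y}" for z g and k :: nat
  proof (induction k)
    case 0
    have "z \<in> carrier G" using CE[OF that(1), of "\<lambda>z. z \<in> carrier G"] xy by simp
    then show ?case using that by simp
  next
    case (Suc k)
    have "z \<in> carrier G" using CE[OF that(1), of "\<lambda>z. z \<in> carrier G"] xy by simp
    then have "z \<otimes> g [^] Suc k = (z \<otimes> g [^] k) \<otimes> g" using that(2) xy by (auto simp: m_assoc)
    then show ?case using Suc that(2) Cx Cy by auto
  qed
  \<comment> \<open>Inverse letters reduce to powers because both generators have finite order; for
    \<open>x\<close>, the fourth power is \<open>y [^] (2 * s) = \<one>\<close>.\<close>
  have invs: "\<exists>k::nat. inv g = g [^] k" if "g \<in> {x, y}" for g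
  proof -
    have "x [^] (4::nat) = y [^] (2 * s)"
      using xy pow_four[of x] by (simp add: xx m_assoc[symmetric]) (simp add: xx nat_pow_mult m_assoc mult_2)
    moreover obtain k where "2 * s = m * k" using arith(1) by (rule dvdE)
    ultimately have "x [^] (4::nat) = \<one>" using ym xy by (simp flip: nat_pow_pow)
    then have "\<exists>k::nat. g [^] Suc k = \<one>"
      using that ym m by (metis Suc_pred' add_gr_0 insertE less_le_trans numeral_eq_Suc singletonD zero_less_Suc zero_less_numeral)
    then obtain k :: nat where "g [^] Suc k = \<one>" ..
    then have "inv g = g [^] k" using that xy by (intro inv_equality) auto
    then show ?thesis ..
  qed
  have "ev u \<in> C" for u
  proof (induction u rule: rev_induct)
    case Nil
    then show ?case using C1[of 0] nil by simp
  next
    case (snoc l u)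
    have "\<exists>g\<in>{x, y}. \<exists>k::nat. ev [l] = g [^] k"
    proof (cases l)
      case (Gen g)
      then have "ev [l] \<in> {x, y}" by (cases g) (auto simp: x_def y_def)
      then show ?thesis using xy nat_pow_eone by (metis empty_iff insert_iff)
    next
      case (GenInv g)
      then show ?thesis using ginv[of g] invs by (cases g) (auto simp flip: x_def y_def)
    qed
    then show ?case using Cpow[OF snoc.IH] ev(2)[of u "[l]"] by auto
  qed
  then have "carrier G \<subseteq> C" unfolding range by (rule image_subsetI)
  moreover have "C \<subseteq> carrier G" using xy by (auto simp: C_def)
  ultimately have gen: "carrier G = powers y \<union> (\<lambda>c. x \<otimes> c) ` powers y"
    unfolding C_def by (rule equalityI)
  define nf where "nf = (\<lambda>(b, k). (if b then [Gen gen_x] else []) @ replicate k (Gen gen_y))"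
  have inj: "inj_on (\<lambda>z. ev (nf z)) (UNIV \<times> {..<m})"
  proof (rule inj_onI)
    fix p q assume pq: "p \<in> UNIV \<times> {..<m}" "q \<in> UNIV \<times> {..<m}" and "ev (nf p) = ev (nf q)"
    then have "word_eq ?R (nf p) (nf q)" using ev(3) by simp
    then have "fold act (nf p) (False, 0) = fold act (nf q) (False, 0)"
      using act_word_eq[of "nf p" "nf q" False 0] by simp
    moreover have "fold act (nf z) (False, 0) = (fst z, int (snd z))" if "z \<in> UNIV \<times> {..<m}" for z
      using that act_normal_form unfolding nf_def by (cases z) (simp del: append_Cons split del: if_split)
    ultimately show "p = q" using pq by (simp add: prod_eq_iff)
  qed
  have nfev: "ev (nf (b, k)) = (if b then x \<otimes> y [^] k else y [^] k)" for b k
    using cons[of "Gen gen_x" "replicate k (Gen gen_y)"] rep by (simp add: nf_def x_def)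
  have ymod: "y [^] i = y [^] (i mod m)" for i
  proof -
    have "y [^] (m * (i div m) + i mod m) = y [^] (m * (i div m)) \<otimes> y [^] (i mod m)"
      using xy by (simp add: nat_pow_mult)
    then show ?thesis using ym xy by (simp flip: nat_pow_pow)
  qed
  have img: "carrier G = (\<lambda>z. ev (nf z)) ` (UNIV \<times> {..<m})"
  proof
    have "y [^] i \<in> (\<lambda>z. ev (nf z)) ` (UNIV \<times> {..<m})" for i :: nat
      using nfev[of False "i mod m"] ymod[of i] m by (intro image_eqI[of _ _ "(False, i mod m)"]) auto
    moreover have "x \<otimes> y [^] i \<in> (\<lambda>z. ev (nf z)) ` (UNIV \<times> {..<m})" for i :: nat
      using nfev[of True "i mod m"] ymod[of i] m by (intro image_eqI[of _ _ "(True, i mod m)"]) auto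
    ultimately show "carrier G \<subseteq> (\<lambda>z. ev (nf z)) ` (UNIV \<times> {..<m})" unfolding gen by blast
  qed (use ev(1) in blast)
  show order: "order G = 2 * m"
    unfolding order_def img using card_image[OF inj] by (simp add: card_cartesian_product)
  show "ordered_davenport G = Suc m"
    by (rule ordered_davenport_metacyclic[OF xy m ym xx yx gen order arith rr])
qed

end

section \<open>The dicyclic and semi-dihedral families\<close>

theorem theorem1p1:
  fixes G :: "('a, 'b) monoid_scheme" and n :: nat
  assumes "n \<ge> 2"
    and "group G"
    and "G \<cong> dicyclic_group n \<or> G \<cong> semidihedral_group n"
  shows "int (ordered_davenport G) = \<lceil>(real (order G) + 1) / 2\<rceil>"
proof -
  \<comment> \<open>Writing \<open>n\<close> with successors lets the truncated subtractions below
    be simplified away.\<close>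
  obtain k where k: "n = Suc (Suc k)" using assms(1) by (metis add_2_eq_Suc le_Suc_ex)
  have "\<exists>m. order G = 2 * m \<and> ordered_davenport G = Suc m"
    using assms(3)
  proof
    assume "G \<cong> dicyclic_group n"
    \<comment> \<open>Dicyclic parameters: \<open>m = 2 * n\<close>, \<open>s = n\<close>,
      \<open>r = 2 * n - 1\<close>.\<close>
    then have iso: "G \<cong> presented_group (metacyclic_relations (2 * n) n [GenInv gen_y])"
      by (simp add: dicyclic_group_def metacyclic_relations_def)
    have "(2 * n - 1) * (2 * n - 1) = 1 + 2 * n * (2 * n - 2)" "(2 * n - 1) * n = n + 2 * n * (n - 1)"
      by (simp_all add: k algebra_simps)
    then have "(2 * n - 1) * (2 * n - 1) mod (2 * n) = 1 mod (2 * n)"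
      and rs: "(2 * n - 1) * n mod (2 * n) = n mod (2 * n)"
      by (simp_all only: mod_mult_self2)
    moreover have "1 mod (2 * n) = 1" using k by simp
    ultimately have rr: "(2 * n - 1) * (2 * n - 1) mod (2 * n) = 1" by simp
    show ?thesis
      using metacyclic_presentation[OF rr rs _ assms(2) iso] assms(1) by auto
  next
    assume "G \<cong> semidihedral_group n"
    \<comment> \<open>Semi-dihedral parameters: \<open>m = 4 * n\<close>, \<open>s = 0\<close>,
      \<open>r = 2 * n - 1\<close>.\<close>
    then have iso: "G \<cong> presented_group (metacyclic_relations (4 * n) 0 (replicate (2 * n - 1) (Gen gen_y)))"
      by (simp add: semidihedral_group_def metacyclic_relations_def)
    have "(2 * n - 1) * (2 * n - 1) = 1 + 4 * n * (n - 1)"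
      by (simp_all add: k algebra_simps)
    then have "(2 * n - 1) * (2 * n - 1) mod (4 * n) = 1 mod (4 * n)"
      by (simp only: mod_mult_self2)
    moreover have "1 mod (4 * n) = 1" using k by simp
    ultimately have rr: "(2 * n - 1) * (2 * n - 1) mod (4 * n) = 1" by simp
    have "2 * (2 * n - 1 + 1) = 4 * n" using k by simp
    then show ?thesis
      using metacyclic_presentation[OF rr _ _ assms(2) iso] assms(1) by auto
  qed
  then obtain m where "order G = 2 * m" "ordered_davenport G = Suc m" by blast
  moreover have "\<lceil>(real (2 * m) + 1) / 2\<rceil> = int (Suc m)" by (simp add: ceiling_eq_iff field_simps)
  ultimately show ?thesis by simp
qed

end
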